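(* Let $\sigma=(1,2,3,4,5)$ and $\eta=(4,5,6)$, which generate the alternating group $A_6$. There is a group homomorphism $\varphi:A_6\to\operatorname{Aut}(\mathbb{Z}_2^{10})$ such that the automorphisms $\varphi(\sigma)$ and $\varphi(\eta)$ are represented, respectively, by the matrices $$M_\sigma=\begin{bmatrix} 1&1&1&1&1&0&0&0&0&0\\ 0&0&1&1&1&0&0&0&0&0\\ 1&0&1&0&1&0&0&0&0&0\\ 0&1&1&1&1&0&0&0&0&0\\ 0&1&0&1&1&0&0&0&0&0\\ 0&0&0&0&0&0&1&0&1&1\\ 0&0&0&0&0&0&1&0&0&0\\ 0&0&0&0&0&1&0&1&1&0\\ 0&0&0&0&0&0&0&1&0&0\\ 0&0&0&0&0&0&0&0&1&0 \end{bmatrix},\qquad M_\eta=\begin{bmatrix} 0&1&0&0&1&0&0&0&0&0\\ 1&1&0&0&1&0&0&0&0&0\\ 0&1&0&1&1&0&0&0&0&0\\ 1&0&1&1&0&0&0&0&0&0\\ 0&0&0&0&1&0&0&0&0&0\\ 0&0&0&0&0&1&1&0&1&0\\ 0&0&0&0&0&0&0&0&1&0\\ 0&0&0&0&0&0&1&0&0&0\\ 0&0&0&0&0&0&0&1&0&0\\ 0&0&0&0&0&0&0&0&0&1 \end{bmatrix}$$ in $\operatorname{GL}_{10}(\mathbb{F}_2)$. For this $\varphi$, the semidirect product $\mathbb{Z}_2^{10}\rtimes_\varphi A_6$ has center of order $4$, and it has exactly one noncommutator, namely the central element $u=(q,\varepsilon)$, where $\varepsilon$ is the identity permutation and $q\in\mathbb{Z}_2^{10}$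 is the column vector with entries $(1,0,1,0,1,1,1,1,1,1)$, in this order.
   Context: For elements $g,h$ of a group $G$, the commutator of $g$ and $h$ is $[g,h]=ghg^{-1}h^{-1}$. An element of $G$ is a commutator if it equals $[g,h]$ for some $g,h\in G$, and a noncommutator otherwise. $\mathbb{Z}_2^{10}$ is the additive group of column vectors of length $10$ over the field $\mathbb{F}_2$. An automorphism of $\mathbb{Z}_2^{10}$ is represented by the invertible $10\times 10$ matrix over $\mathbb{F}_2$ whose columns are the images of the standard basis vectors, so that it acts by left multiplication on column vectors. $A_6$ is the alternating group of degree $6$ under function composition. Writing $M_\alpha\in\operatorname{GL}_{10}(\mathbb{F}_2)$ for the matrix representing $\varphi(\alpha)$, the group $\mathbb{Z}_2^{10}\rtimes_\varphi A_6$ has underlying set $\mathbb{Z}_2^{10}\times A_6$ with product $(s,\alpha)(t,\beta)=(s+M_\alpha t,\ \alpha\beta)$. *)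

theory Defs
  imports
    "HOL-Algebra.Sym_Groups"
    "HOL-Algebra.Bij"
    "HOL-Library.Z2"
    "HOL-Combinatorics.Cycles"
    "Jordan_Normal_Form.Matrix"
begin

definition center :: "('a, 'b) monoid_scheme \<Rightarrow> 'a set" where
  "center G = {z \<in> carrier G. \<forall>g \<in> carrier G. z \<otimes>\<^bsub>G\<^esub> g = g \<otimes>\<^bsub>G\<^esub> z}"

text \<open>\<^term>\<open>derived_set G (carrier G)\<close> is the set of commutators
  \<open>g h g\<^sup>-\<^sup>1 h\<^sup>-\<^sup>1\<close> themselves, not the subgroup they generate.\<close>

definition noncommutators :: "('a, 'b) monoid_scheme \<Rightarrow> 'a set" where
  "noncommutators G = carrier G - derived_set G (carrier G)"

abbreviation Z2_10 :: "bit vec monoid" where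
  "Z2_10 \<equiv> monoid_vec TYPE(bit) 10"

abbreviation GL10 :: "bit mat monoid" where
  "GL10 \<equiv> units_of (ring_mat TYPE(bit) 10 ())"

definition aut_mat :: "(bit vec \<Rightarrow> bit vec) \<Rightarrow> bit mat" where
  "aut_mat f = mat_of_cols 10 (map (\<lambda>j. f (unit_vec 10 j)) [0..<10])"

definition semidirect ::
  "((nat \<Rightarrow> nat) \<Rightarrow> bit vec \<Rightarrow> bit vec) \<Rightarrow> (bit vec \<times> (nat \<Rightarrow> nat)) monoid" where
  "semidirect \<phi> =
    \<lparr> carrier = carrier Z2_10 \<times> carrier (alt_group 6),
      mult = (\<lambda>(s, \<alpha>) (t, \<beta>). (s + aut_mat (\<phi> \<alpha>) *\<^sub>v t, \<alpha> \<otimes>\<^bsub>alt_group 6\<^esub> \<beta>)),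
      one = (\<one>\<^bsub>Z2_10\<^esub>, \<one>\<^bsub>alt_group 6\<^esub>) \<rparr>"

definition \<sigma> :: "nat \<Rightarrow> nat" where
  "\<sigma> = cycle_of_list [1, 2, 3, 4, 5]"

definition \<eta> :: "nat \<Rightarrow> nat" where
  "\<eta> = cycle_of_list [4, 5, 6]"

definition M_\<sigma> :: "bit mat" where
  "M_\<sigma> = mat_of_rows_list 10
    [[1,1,1,1,1,0,0,0,0,0],
     [0,0,1,1,1,0,0,0,0,0],
     [1,0,1,0,1,0,0,0,0,0],
     [0,1,1,1,1,0,0,0,0,0],
     [0,1,0,1,1,0,0,0,0,0],
     [0,0,0,0,0,0,1,0,1,1],
     [0,0,0,0,0,0,1,0,0,0],
     [0,0,0,0,0,1,0,1,1,0],
     [0,0,0,0,0,0,0,1,0,0],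
     [0,0,0,0,0,0,0,0,1,0]]"

definition M_\<eta> :: "bit mat" where
  "M_\<eta> = mat_of_rows_list 10
    [[0,1,0,0,1,0,0,0,0,0],
     [1,1,0,0,1,0,0,0,0,0],
     [0,1,0,1,1,0,0,0,0,0],
     [1,0,1,1,0,0,0,0,0,0],
     [0,0,0,0,1,0,0,0,0,0],
     [0,0,0,0,0,1,1,0,1,0],
     [0,0,0,0,0,0,0,0,1,0],
     [0,0,0,0,0,0,1,0,0,0],
     [0,0,0,0,0,0,0,1,0,0],
     [0,0,0,0,0,0,0,0,0,1]]"

definition q :: "bit vec" where
  "q = vec_of_list [1,0,1,0,1,1,1,1,1,1]"

definition u :: "bit vec \<times> (nat \<Rightarrow> nat)" where
  "u = (q, id)"

end

theory Submission
  imports Defs "HOL-Library.Function_Algebras"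
begin

text \<open>
  Each diagonal block of the two matrices is the module of even-weight vectors in the permutation
  module over the field with two elements on six letters: the second block for the natural action
  of \<open>A\<^sub>6\<close>, the first one for its action on the six synthematic totals (that is, twisted by an outer
  automorphism). So \<open>V\<close> consists of the functions on twelve letters, the points \<open>1..6\<close> and the totals
  \<open>7..12\<close>, that have even weight on both halves.

  The elements \<open>(w, [b, c])\<close> with \<open>w \<in> (1 + b) V + (1 + c) V\<close> are commutators. If \<open>b\<close> and \<open>c\<close> generate
  \<open>A\<^sub>6\<close>, this sum is all of \<open>V\<close>, and every conjugacy class of nontrivial elements except those of order 3
  is represented by such a \<open>[b, c]\<close> with 5-cycles \<open>b\<close> and \<open>c\<close>; for order 3, two subgroups \<open>A\<^sub>5\<close> and one
  \<open>S\<^sub>4\<close> together suffice. Over the identity, 5-cycles and Klein four-groups produce every vector except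
  the all-ones vector \<open>q\<close>. Conversely, two commuting permutations always have a common invariant odd
  subset of the points or of the totals (invariant up to complement); summation over it is an
  invariant functional that vanishes on the vector part of their commutators but not on \<open>q\<close>.
\<close>

text \<open>The obstacle is to reduce statements about 360 permutations and 1024 vectors to
  evaluations at single letters. Permutations are therefore words in two generators, and two of them
  are compared at the points 1, 2, 3, 4 only, since A6 is sharply 4-transitive. The same
  transitivity relabels every nontrivial element into one of nine normal forms, each determined by
  its values at these four points. Vectors are not enumerated either. The sum (1 + b) V + (1 + c) V
  is bounded from below by a graph on the twelve letters, in which i and j are joined when e_i + e_j
  is known to lie in the sum. A walk in this graph yields every vector of even weight supported on
  its letters, so a few words and a few walks certify a whole subspace of commutators at once. Both
  halves of V matter in the converse as well: one type of Klein four-group leaves no suitable odd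
  set of points but fixes a total.\<close>

declare One_nat_def [simp del]

section \<open>The action of the alternating group on points and synthematic totals\<close>

text \<open>The letters 7 to 12 number the six totals listed in \<open>total\<close>, and the cycles
  on them are what \<sigma> and \<eta> induce there. The 3-cycle (4,5,6) becomes a product of two
  3-cycles, the mark of an outer automorphism of A6.\<close>

definition s12 :: "nat \<Rightarrow> nat" where
  "s12 = cycle_of_list [1, 2, 3, 4, 5] \<circ> cycle_of_list [7, 8, 9, 10, 11]"

definition e12 :: "nat \<Rightarrow> nat" where
  "e12 = cycle_of_list [4, 5, 6] \<circ> cycle_of_list [7, 8, 10] \<circ> cycle_of_list [9, 11, 12]"

datatype letter = S | E

primrec letter_perm :: "letter \<Rightarrow> nat \<Rightarrow> nat" where
  "letter_perm S = s12"
| "letter_perm E = e12"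

fun word :: "letter list \<Rightarrow> nat \<Rightarrow> nat" where
  "word [] = id"
| "word (x # xs) = letter_perm x \<circ> word xs"

text \<open>Positive words suffice: permutations of finitely many letters have finite order, so
  inverses are powers (\<open>inv_Gamma\<close>).\<close>

definition \<Gamma> :: "(nat \<Rightarrow> nat) set" where
  "\<Gamma> = range word"

abbreviation points :: "nat set" where "points \<equiv> {1..6}"
abbreviation totals :: "nat set" where "totals \<equiv> {7..12}"

lemma points_eq: "points = {1, 2, 3, 4, 5, 6}" by auto
lemma totals_eq: "totals = {7, 8, 9, 10, 11, 12}" by auto
lemma twelve_eq: "{1..12::nat} = points \<union> totals" by auto

lemma s12_apply [simp]:
  "s12 1 = 2" "s12 2 = 3" "s12 3 = 4" "s12 4 = 5" "s12 5 = 1" "s12 6 = 6"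
  "s12 7 = 8" "s12 8 = 9" "s12 9 = 10" "s12 10 = 11" "s12 11 = 7" "s12 12 = 12"
  by (simp_all add: s12_def transpose_def)

lemma e12_apply [simp]:
  "e12 1 = 1" "e12 2 = 2" "e12 3 = 3" "e12 4 = 5" "e12 5 = 6" "e12 6 = 4"
  "e12 7 = 8" "e12 8 = 10" "e12 9 = 11" "e12 10 = 7" "e12 11 = 12" "e12 12 = 9"
  by (simp_all add: e12_def transpose_def)

lemma letter_perm_permutes: "letter_perm x permutes {1..12}"
proof (cases x)
  case S
  have "cycle_of_list [1, 2, 3, 4, 5::nat] permutes {1..12}"
    "cycle_of_list [7, 8, 9, 10, 11::nat] permutes {1..12}"
    by (rule permutes_subset[OF cycle_permutes]; auto)+
  then show ?thesis by (simp add: S s12_def permutes_compose del: cycle_of_list.simps)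
next
  case E
  have "cycle_of_list [4, 5, 6::nat] permutes {1..12}"
    "cycle_of_list [7, 8, 10::nat] permutes {1..12}"
    "cycle_of_list [9, 11, 12::nat] permutes {1..12}"
    by (rule permutes_subset[OF cycle_permutes]; auto)+
  then show ?thesis by (simp add: E e12_def permutes_compose del: cycle_of_list.simps)
qed

lemma word_append: "word (xs @ ys) = word xs \<circ> word ys"
  by (induction xs) (simp_all add: o_assoc)

lemma word_in_Gamma [simp]: "word xs \<in> \<Gamma>"
  by (simp add: \<Gamma>_def)

lemma id_Gamma [simp]: "id \<in> \<Gamma>"
  using word_in_Gamma[of "[]"] by simp

lemma s12_Gamma [simp]: "s12 \<in> \<Gamma>"
  using word_in_Gamma[of "[S]"] by simp

lemma e12_Gamma [simp]: "e12 \<in> \<Gamma>"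
  using word_in_Gamma[of "[E]"] by simp

lemma comp_Gamma [simp]: "g \<in> \<Gamma> \<Longrightarrow> h \<in> \<Gamma> \<Longrightarrow> g \<circ> h \<in> \<Gamma>"
  by (auto simp: \<Gamma>_def simp flip: word_append)

lemma Gamma_induct [consumes 1, case_names id s12 e12]:
  assumes "g \<in> \<Gamma>" "P id"
    "\<And>g. g \<in> \<Gamma> \<Longrightarrow> P g \<Longrightarrow> P (s12 \<circ> g)" "\<And>g. g \<in> \<Gamma> \<Longrightarrow> P g \<Longrightarrow> P (e12 \<circ> g)"
  shows "P g"
proof -
  have "P (word xs)" for xs
  proof (induction xs)
    case (Cons x xs)
    then show ?case using assms(3,4)[of "word xs"]
      by (cases x) (simp_all only: word.simps letter_perm.simps word_in_Gamma)
  qed (simp only: word.simps assms(2))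
  then show ?thesis using assms(1) by (auto simp: \<Gamma>_def)
qed

lemma Gamma_permutes: "g \<in> \<Gamma> \<Longrightarrow> g permutes {1..12}"
proof (induction rule: Gamma_induct)
  case (s12 g)
  then show ?case using letter_perm_permutes[of S] by (simp only: letter_perm.simps permutes_compose)
next
  case (e12 g)
  then show ?case using letter_perm_permutes[of E] by (simp only: letter_perm.simps permutes_compose)
qed (rule permutes_id)

lemma Gamma_bij [simp]: "g \<in> \<Gamma> \<Longrightarrow> bij g"
  using Gamma_permutes permutes_bij by blast

lemma Gamma_funpow: "g \<in> \<Gamma> \<Longrightarrow> g ^^ n \<in> \<Gamma>"
  by (induction n) auto

lemma inv_Gamma [simp]:
  assumes "g \<in> \<Gamma>" shows "inv' g \<in> \<Gamma>"
proof -
  have "permutation g"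
    using Gamma_permutes[OF assms] permutation_permutes by blast
  then obtain n where n: "g ^^ n = id" "n > 0"
    using permutation_is_nilpotent by blast
  then have "g \<circ> g ^^ (n - 1) = id"
    by (metis Suc_pred' funpow.simps(2))
  then have "inv' g = g ^^ (n - 1)"
    using bij_is_inj[OF Gamma_bij[OF assms]]
    by (metis inv_o_cancel comp_id id_comp o_assoc)
  then show ?thesis using Gamma_funpow[OF assms] by simp
qed

lemma s12_e12_image:
  "s12 ` points = points" "e12 ` points = points" "s12 ` totals = totals" "e12 ` totals = totals"
  unfolding points_eq totals_eq image_insert s12_apply e12_apply image_empty by blast+

lemma Gamma_points: "g \<in> \<Gamma> \<Longrightarrow> g ` points = points"
proof (induction rule: Gamma_induct)
  case id show ?case by simp
qed (simp_all only: image_comp [symmetric] s12_e12_image)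

lemma Gamma_totals: "g \<in> \<Gamma> \<Longrightarrow> g ` totals = totals"
proof (induction rule: Gamma_induct)
  case id show ?case by simp
qed (simp_all only: image_comp [symmetric] s12_e12_image)

lemma Gamma_outside: "g \<in> \<Gamma> \<Longrightarrow> i \<notin> {1..12} \<Longrightarrow> g i = i"
  using Gamma_permutes permutes_not_in by metis

lemma Gamma_eqI:
  assumes "g \<in> \<Gamma>" "h \<in> \<Gamma>" "\<And>i. i \<in> points \<Longrightarrow> g i = h i" "\<And>i. i \<in> totals \<Longrightarrow> g i = h i"
  shows "g = h"
proof
  fix i :: nat
  consider "i \<in> points" | "i \<in> totals" | "i \<notin> {1..12}" by force
  then show "g i = h i"
    by cases (use assms Gamma_outside in metis)+
qed

text \<open>Each value consists of five synthemes (partitions of the points into three pairs) that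
  together contain each of the fifteen pairs exactly once. The last branch is the total numbered
  12.\<close>

definition total :: "nat \<Rightarrow> nat set set set" where
  "total t =
    (if t = 7 then {{{1,2},{3,5},{4,6}}, {{1,3},{2,4},{5,6}}, {{1,4},{2,5},{3,6}}, {{1,5},{2,6},{3,4}}, {{1,6},{2,3},{4,5}}}
     else if t = 8 then {{{1,2},{3,6},{4,5}}, {{1,3},{2,5},{4,6}}, {{1,4},{2,3},{5,6}}, {{1,5},{2,6},{3,4}}, {{1,6},{2,4},{3,5}}}
     else if t = 9 then {{{1,2},{3,6},{4,5}}, {{1,3},{2,4},{5,6}}, {{1,4},{2,6},{3,5}}, {{1,5},{2,3},{4,6}}, {{1,6},{2,5},{3,4}}}
     else if t = 10 then {{{1,2},{3,4},{5,6}}, {{1,3},{2,6},{4,5}}, {{1,4},{2,5},{3,6}}, {{1,5},{2,3},{4,6}}, {{1,6},{2,4},{3,5}}}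
     else if t = 11 then {{{1,2},{3,4},{5,6}}, {{1,3},{2,5},{4,6}}, {{1,4},{2,6},{3,5}}, {{1,5},{2,4},{3,6}}, {{1,6},{2,3},{4,5}}}
     else {{{1,2},{3,5},{4,6}}, {{1,3},{2,6},{4,5}}, {{1,4},{2,3},{5,6}}, {{1,5},{2,4},{3,6}}, {{1,6},{2,5},{3,4}}})"

lemma total_s12: "t \<in> totals \<Longrightarrow> total (s12 t) = ((`) ((`) s12)) ` total t"
  by (simp add: totals_eq) (elim disjE; simp add: total_def insert_commute)

lemma total_e12: "t \<in> totals \<Longrightarrow> total (e12 t) = ((`) ((`) e12)) ` total t"
  by (simp add: totals_eq) (elim disjE; simp add: total_def insert_commute)

lemma total_equivariant:
  assumes "g \<in> \<Gamma>" "t \<in> totals"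
  shows "total (g t) = ((`) ((`) g)) ` total t"
  using assms
proof (induction arbitrary: t rule: Gamma_induct)
  case (s12 g)
  then have "g t \<in> totals" using Gamma_totals by blast
  with s12 show ?case by (simp add: total_s12 image_image)
next
  case (e12 g)
  then have "g t \<in> totals" using Gamma_totals by blast
  with e12 show ?case by (simp add: total_e12 image_image)
qed simp

lemma total_inj: "inj_on total totals"
proof (rule inj_onI)
  \<comment> \<open>Four yes/no tests, each asking whether two given pairs of points lie in a common
    syntheme, give the six totals six different patterns. This replaces a comparison of nested sets
    for every two totals.\<close>
  define joins where "joins a b T \<longleftrightarrow> (\<exists>y\<in>T. a \<in> y \<and> b \<in> y)" for a b :: "nat set" and T
  define key where "key T =
    (joins {1,2} {3,5} T, joins {1,3} {2,4} T, joins {1,2} {3,4} T, joins {1,3} {2,6} T)" for T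
  have key: "key (total t) =
      (t = 7 \<or> t = 12, t = 7 \<or> t = 9, t = 10 \<or> t = 11, t = 10 \<or> t = 12)"
    if "t \<in> totals" for t
    using that unfolding totals_eq
    by (elim insertE emptyE) (simp_all add: total_def key_def joins_def doubleton_eq_iff)
  fix t t' assume t: "t \<in> totals" "t' \<in> totals" and eq: "total t = total t'"
  have "(t = 7 \<or> t = 12, t = 7 \<or> t = 9, t = 10 \<or> t = 11, t = 10 \<or> t = 12) =
      (t' = 7 \<or> t' = 12, t' = 7 \<or> t' = 9, t' = 10 \<or> t' = 11, t' = 10 \<or> t' = 12)"
    unfolding key [OF t(1), symmetric] key [OF t(2), symmetric] eq ..
  with t show "t = t'"
    unfolding totals_eq by (elim insertE emptyE) simp_all
qed

text \<open>The action on totals is induced by the action on points, and distinct letters name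
  distinct totals. Hence \<Gamma>, a priori some subgroup of a product of two symmetric groups,
  projects injectively to the points.\<close>

lemma Gamma_eq_points:
  assumes "g \<in> \<Gamma>" "h \<in> \<Gamma>" "\<And>i. i \<in> points \<Longrightarrow> g i = h i"
  shows "g = h"
proof (rule Gamma_eqI[OF assms])
  fix t :: nat assume t: "t \<in> totals"
  have sub: "\<Union> (\<Union> (total t)) \<subseteq> points"
    using t unfolding totals_eq points_eq by (elim insertE emptyE) (simp_all add: total_def)
  have "((`) ((`) g)) ` total t = ((`) ((`) h)) ` total t"
  proof (intro image_cong refl)
    fix y d i assume "y \<in> total t" "d \<in> y" "i \<in> d"
    then have "i \<in> points" using sub by blast
    then show "g i = h i" using assms(3) by blast
  qed
  then have "total (g t) = total (h t)"
    using t assms by (simp add: total_equivariant)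
  moreover have "g t \<in> totals" "h t \<in> totals" using t assms Gamma_totals by blast+
  ultimately show "g t = h t" using total_inj by (auto dest: inj_onD)
qed

section \<open>Sharp fourfold transitivity\<close>

lemma Gamma_in_points: "g \<in> \<Gamma> \<Longrightarrow> i \<in> points \<Longrightarrow> g i \<in> points"
  using Gamma_points by blast

lemma Gamma_in_totals: "g \<in> \<Gamma> \<Longrightarrow> i \<in> totals \<Longrightarrow> g i \<in> totals"
  using Gamma_totals by blast

lemma Gamma_eq_iff: "g \<in> \<Gamma> \<Longrightarrow> g i = g j \<longleftrightarrow> i = j"
  using Gamma_bij bij_is_inj inj_eq by metis

lemma inv_Gamma_cancel [simp]:
  assumes "g \<in> \<Gamma>"
  shows "g \<circ> inv' g = id" "inv' g \<circ> g = id" "inv' g (g i) = i" "g (inv' g i) = i"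
proof -
  have "bij g" using assms by simp
  then show "g \<circ> inv' g = id" "inv' g \<circ> g = id" "inv' g (g i) = i" "g (inv' g i) = i"
    by (auto simp: bij_is_inj bij_is_surj surj_iff inv_f_f surj_f_inv_f)
qed

section \<open>The isomorphism from \<Gamma> onto A6\<close>

definition on_points :: "(nat \<Rightarrow> nat) \<Rightarrow> nat \<Rightarrow> nat" where
  "on_points g i = (if i \<in> points then g i else i)"

lemma on_points_comp: "h \<in> \<Gamma> \<Longrightarrow> on_points (g \<circ> h) = on_points g \<circ> on_points h"
  by (rule ext) (auto simp: on_points_def dest: Gamma_in_points)

lemma on_points_id: "on_points id = id"
  by (rule ext) (simp add: on_points_def)

lemma on_points_s12: "on_points s12 = \<sigma>"
  by (rule ext) (auto simp: on_points_def s12_def \<sigma>_def transpose_def)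

lemma on_points_e12: "on_points e12 = \<eta>"
  by (rule ext) (auto simp: on_points_def e12_def \<eta>_def transpose_def)

lemma sigma_alt: "\<sigma> \<in> carrier (alt_group 6)"
proof -
  have "\<sigma> permutes points"
    unfolding \<sigma>_def by (rule permutes_subset[OF cycle_permutes]) auto
  moreover have "evenperm \<sigma>"
    by (simp add: \<sigma>_def evenperm_comp evenperm_swap permutation_compose permutation_swap_id)
  ultimately show ?thesis by (simp add: alt_group_carrier)
qed

lemma eta_alt: "\<eta> \<in> carrier (alt_group 6)"
proof -
  have "\<eta> permutes points"
    unfolding \<eta>_def by (rule permutes_subset[OF cycle_permutes]) auto
  moreover have "evenperm \<eta>"
    by (simp add: \<eta>_def evenperm_comp evenperm_swap permutation_compose permutation_swap_id)
  ultimately show ?thesis by (simp add: alt_group_carrier)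
qed

lemma alt_comp:
  "\<alpha> \<in> carrier (alt_group 6) \<Longrightarrow> \<beta> \<in> carrier (alt_group 6) \<Longrightarrow> \<alpha> \<circ> \<beta> \<in> carrier (alt_group 6)"
  using group.subgroup_self[OF alt_group_is_group, THEN subgroup.m_closed]
  by (metis alt_group_mult)

lemma on_points_generate: "g \<in> \<Gamma> \<Longrightarrow> on_points g \<in> generate (alt_group 6) {\<sigma>, \<eta>}"
proof (induction rule: Gamma_induct)
  case id
  show ?case unfolding on_points_id by (metis alt_group_one generate.one)
next
  case (s12 g)
  then show ?case unfolding on_points_comp[OF s12(1)] on_points_s12
    by (metis alt_group_mult generate.eng generate.incl insertI1)
next
  case (e12 g)
  then show ?case unfolding on_points_comp[OF e12(1)] on_points_e12
    by (metis alt_group_mult generate.eng generate.incl insertI1 insertI2)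
qed

lemma on_points_alt:
  assumes "g \<in> \<Gamma>" shows "on_points g \<in> carrier (alt_group 6)"
proof -
  have "generate (alt_group 6) {\<sigma>, \<eta>} \<subseteq> carrier (alt_group 6)"
    by (intro group.generate_incl alt_group_is_group) (simp add: sigma_alt eta_alt)
  then show ?thesis using on_points_generate[OF assms] by blast
qed

lemma on_points_inj: "inj_on on_points \<Gamma>"
proof (rule inj_onI)
  fix g h assume "g \<in> \<Gamma>" "h \<in> \<Gamma>" "on_points g = on_points h"
  then show "g = h"
    by (intro Gamma_eq_points) (auto simp: on_points_def fun_eq_iff split: if_splits)
qed

text \<open>Only 5 and 6 remain to be permuted, and exchanging them would be odd.\<close>

lemma alt_fix_four:
  assumes \<beta>: "\<beta> \<in> carrier (alt_group 6)" and fix4: "\<beta> 1 = 1" "\<beta> 2 = 2" "\<beta> 3 = 3" "\<beta> 4 = 4"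
  shows "\<beta> = id"
proof -
  have perm: "\<beta> permutes points" and even: "evenperm \<beta>"
    using \<beta> by (auto simp: alt_group_carrier)
  have inj: "\<beta> i = \<beta> j \<longleftrightarrow> i = j" for i j
    using permutes_inj[OF perm] by (simp add: inj_eq)
  have "\<beta> 5 \<in> points" "\<beta> 6 \<in> points"
    using permutes_in_image[OF perm] by auto
  then have "\<beta> 5 = 5 \<and> \<beta> 6 = 6 \<or> \<beta> 5 = 6 \<and> \<beta> 6 = 5"
    using inj[of 5 1] inj[of 5 2] inj[of 5 3] inj[of 5 4] inj[of 5 6]
      inj[of 6 1] inj[of 6 2] inj[of 6 3] inj[of 6 4] fix4
    unfolding points_eq by auto
  moreover have "\<beta> = transpose 5 6" if "\<beta> 5 = 6" "\<beta> 6 = 5"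
  proof
    fix i show "\<beta> i = transpose 5 6 i"
    proof (cases "i \<in> points")
      case True
      then show ?thesis unfolding points_eq using that fix4 by (auto simp: transpose_def)
    next
      case False
      then show ?thesis using permutes_not_in[OF perm] by (auto simp: transpose_def)
    qed
  qed
  moreover have "\<beta> = id" if "\<beta> 5 = 5" "\<beta> 6 = 6"
  proof
    fix i show "\<beta> i = id i"
    proof (cases "i \<in> points")
      case True
      then show ?thesis unfolding points_eq using that fix4 by auto
    next
      case False
      then show ?thesis using permutes_not_in[OF perm] by auto
    qed
  qed
  ultimately show ?thesis using even by (auto simp: evenperm_swap)
qed

lemma Gamma_fix_four:
  assumes "g \<in> \<Gamma>" "g 1 = 1" "g 2 = 2" "g 3 = 3" "g 4 = 4"
  shows "g = id"
proof -
  have "on_points g = on_points id"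
    using alt_fix_four[OF on_points_alt[OF assms(1)]] assms(2-)
    unfolding on_points_id by (simp add: on_points_def)
  then show ?thesis using on_points_inj assms(1) by (auto dest: inj_onD)
qed

lemma Gamma_eq_four:
  assumes "g \<in> \<Gamma>" "h \<in> \<Gamma>" "g 1 = h 1" "g 2 = h 2" "g 3 = h 3" "g 4 = h 4"
  shows "g = h"
proof -
  have "inv' h \<circ> g = id"
    by (rule Gamma_fix_four) (simp_all add: assms)
  then show ?thesis
    using inv_Gamma_cancel(1)[OF assms(2)] by (metis comp_id id_comp o_assoc)
qed

text \<open>Top of a stabilizer chain: here and in the next three lemmas explicit words exhibit
  orbits of length 6, 5, 4 and 3, with product 360, under the group and the successive stabilizers
  of 1, 2 and 3.\<close>

lemma transitive_1:
  assumes "p \<in> points" obtains g where "g \<in> \<Gamma>" "g 1 = p"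
proof -
  have "\<exists>xs \<in> {[], [S], [S,S], [S,S,S], [S,S,S,S], [E,S,S,S,S]}. word xs 1 = p"
    using assms unfolding points_eq by (elim insertE emptyE) simp_all
  then show ?thesis using that word_in_Gamma by blast
qed

lemma transitive_2:
  assumes "p \<in> points" "p \<noteq> 1" obtains g where "g \<in> \<Gamma>" "g 1 = 1" "g 2 = p"
proof -
  have "\<exists>xs \<in> {[], [S,S,S,E,S,S], [E,S,E,S,S,S], [E,E,S,E,S,S,S], [S,E,S,S,S]}.
      word xs 1 = 1 \<and> word xs 2 = p"
    using assms unfolding points_eq by (elim insertE emptyE) simp_all
  then show ?thesis using that word_in_Gamma by blast
qed

lemma transitive_3:
  assumes "p \<in> points" "p \<noteq> 1" "p \<noteq> 2"
  obtains g where "g \<in> \<Gamma>" "g 1 = 1" "g 2 = 2" "g 3 = p"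
proof -
  have "\<exists>xs \<in> {[], [S,S,S,S,E,S], [S,E,S,E,S,S], [E,S,E,S,E,S,S]}.
      word xs 1 = 1 \<and> word xs 2 = 2 \<and> word xs 3 = p"
    using assms unfolding points_eq by (elim insertE emptyE) simp_all
  then show ?thesis using that word_in_Gamma by blast
qed

lemma transitive_4:
  assumes "p \<in> points" "p \<noteq> 1" "p \<noteq> 2" "p \<noteq> 3"
  obtains g where "g \<in> \<Gamma>" "g 1 = 1" "g 2 = 2" "g 3 = 3" "g 4 = p"
proof -
  have "\<exists>xs \<in> {[], [E], [E,E]}. word xs 1 = 1 \<and> word xs 2 = 2 \<and> word xs 3 = 3 \<and> word xs 4 = p"
    using assms unfolding points_eq by (elim insertE emptyE) simp_all
  then show ?thesis using that word_in_Gamma by blast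
qed

lemma four_transitive:
  assumes "{a, b, c, d} \<subseteq> points" "distinct [a, b, c, d]"
  obtains g where "g \<in> \<Gamma>" "g 1 = a" "g 2 = b" "g 3 = c" "g 4 = d"
proof -
  obtain f where f: "f \<in> \<Gamma>" "f 1 = a" using transitive_1 assms(1) by blast
  have inv_pt: "inv' g x \<in> points" if "g \<in> \<Gamma>" "x \<in> points" for g x
    using Gamma_in_points inv_Gamma that by blast
  have inv_ne: "inv' g x \<noteq> y" if "g \<in> \<Gamma>" "g y \<noteq> x" for g x y
    using inv_Gamma_cancel(4)[OF that(1)] that(2) by metis
  \<comment> \<open>Each further factor is chosen for the target pulled back through the product so
    far; it fixes the letters already placed.\<close>
  obtain g where g: "g \<in> \<Gamma>" "g 1 = 1" "g 2 = inv' f b"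
    using transitive_2[of "inv' f b"] inv_pt[of f b] inv_ne[of f 1 b] f assms by auto
  have fg: "f \<circ> g \<in> \<Gamma>" "(f \<circ> g) 1 = a" "(f \<circ> g) 2 = b" using f g by simp_all
  obtain h where h: "h \<in> \<Gamma>" "h 1 = 1" "h 2 = 2" "h 3 = inv' (f \<circ> g) c"
    using transitive_3[of "inv' (f \<circ> g) c"] inv_pt[of "f \<circ> g" c]
      inv_ne[of "f \<circ> g" 1 c] inv_ne[of "f \<circ> g" 2 c] fg assms by auto
  have fgh: "f \<circ> g \<circ> h \<in> \<Gamma>" "(f \<circ> g \<circ> h) 1 = a" "(f \<circ> g \<circ> h) 2 = b" "(f \<circ> g \<circ> h) 3 = c"
    using fg h inv_Gamma_cancel(4)[OF fg(1), of c] by simp_all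
  obtain k where k: "k \<in> \<Gamma>" "k 1 = 1" "k 2 = 2" "k 3 = 3" "k 4 = inv' (f \<circ> g \<circ> h) d"
    using transitive_4[of "inv' (f \<circ> g \<circ> h) d"] inv_pt[of "f \<circ> g \<circ> h" d]
      inv_ne[of "f \<circ> g \<circ> h" 1 d] inv_ne[of "f \<circ> g \<circ> h" 2 d] inv_ne[of "f \<circ> g \<circ> h" 3 d]
      fgh assms by auto
  show ?thesis
    using fgh k inv_Gamma_cancel(4)[OF fgh(1), of d] by (intro that[of "f \<circ> g \<circ> h \<circ> k"]) simp_all
qed

text \<open>Fourfold transitivity gives an element of \<Gamma> that agrees with \<alpha> at 1, 2, 3,
  4; the quotient of the two is even and fixes four points, so it is trivial.\<close>

lemma on_points_surj:
  assumes "\<alpha> \<in> carrier (alt_group 6)" obtains g where "g \<in> \<Gamma>" "on_points g = \<alpha>"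
proof -
  have perm: "\<alpha> permutes points" using assms by (simp add: alt_group_carrier)
  have "{\<alpha> 1, \<alpha> 2, \<alpha> 3, \<alpha> 4} \<subseteq> points" using permutes_in_image[OF perm] by auto
  moreover have "distinct [\<alpha> 1, \<alpha> 2, \<alpha> 3, \<alpha> 4]"
    using permutes_inj[OF perm] by (simp add: inj_eq)
  ultimately obtain g where g: "g \<in> \<Gamma>" "g 1 = \<alpha> 1" "g 2 = \<alpha> 2" "g 3 = \<alpha> 3" "g 4 = \<alpha> 4"
    using four_transitive by blast
  have pg: "on_points g permutes points"
    using on_points_alt[OF g(1)] by (simp add: alt_group_carrier)
  have "inv' (on_points g) \<circ> \<alpha> = id"
  proof (rule alt_fix_four)
    show "inv' (on_points g) \<circ> \<alpha> \<in> carrier (alt_group 6)"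
      by (intro alt_comp alt_group_inv_closed on_points_alt g assms)
    have *: "inv' (on_points g) (g i) = i" if "i \<in> points" for i
      using that permutes_inverses(2)[OF pg, of i] by (simp add: on_points_def)
    show "(inv' (on_points g) \<circ> \<alpha>) 1 = 1" "(inv' (on_points g) \<circ> \<alpha>) 2 = 2"
      "(inv' (on_points g) \<circ> \<alpha>) 3 = 3" "(inv' (on_points g) \<circ> \<alpha>) 4 = 4"
      using *[of 1] *[of 2] *[of 3] *[of 4] g by simp_all
  qed
  then have "on_points g = \<alpha>"
    using permutes_inv_o(1)[OF pg] by (metis comp_id id_comp o_assoc)
  then show ?thesis using that g(1) by blast
qed

lemma generate_sigma_eta: "generate (alt_group 6) {\<sigma>, \<eta>} = carrier (alt_group 6)"
proof
  show "generate (alt_group 6) {\<sigma>, \<eta>} \<subseteq> carrier (alt_group 6)"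
    by (intro group.generate_incl alt_group_is_group) (simp add: sigma_alt eta_alt)
  show "carrier (alt_group 6) \<subseteq> generate (alt_group 6) {\<sigma>, \<eta>}"
    using on_points_surj on_points_generate by (metis subsetI)
qed

section \<open>Commutators of the model group\<close>

text \<open>Bit sums stay additive instead of turning into xor, and sums of vectors stay
  unevaluated, so that cancellation proceeds by commutativity and \<open>x + x = 0\<close>.
  Pointwise evaluation is requested through \<open>fun_apply\<close>.\<close>

declare add_bit_eq_xor [simp del] mult_bit_eq_and [simp del]
declare plus_fun_apply [simp del] zero_fun_apply [simp del]

lemmas fun_apply = plus_fun_apply zero_fun_apply

lemma bit_add_self [simp]: "x + x = 0" "x + (x + y) = y" for x y :: bit
  by (cases x; simp)+

section \<open>The module of even vectors and the commutator equation\<close>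

definition evens :: "(nat \<Rightarrow> bit) set" where
  "evens = {w. (\<forall>i. i \<notin> {1..12} \<longrightarrow> w i = 0) \<and> sum w points = 0 \<and> sum w totals = 0}"

definition act :: "(nat \<Rightarrow> nat) \<Rightarrow> (nat \<Rightarrow> bit) \<Rightarrow> nat \<Rightarrow> bit" where
  "act g w = w \<circ> inv' g"

text \<open>This is (w, g) (t, b) (s, a) = (s, a) (t, b), that is (w, g) = [(s, a), (t, b)], read
  off in both components. Clearing the inverses leaves only sums of translates of s and t.\<close>

definition comm :: "(nat \<Rightarrow> bit) \<Rightarrow> (nat \<Rightarrow> nat) \<Rightarrow> bool" where
  "comm w g \<longleftrightarrow> (\<exists>s\<in>evens. \<exists>t\<in>evens. \<exists>a\<in>\<Gamma>. \<exists>b\<in>\<Gamma>.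
     g \<circ> b \<circ> a = a \<circ> b \<and> w + act g t + act (g \<circ> b) s = s + act a t)"

lemma fun_add_self [simp]: "w + w = 0" "w + (w + v) = v" for w v :: "nat \<Rightarrow> bit"
  by (rule ext; simp add: fun_apply)+

lemma act_apply: "g \<in> \<Gamma> \<Longrightarrow> act g w (g i) = w i"
  by (simp add: act_def)

lemma act_id [simp]: "act id w = w"
  by (simp add: act_def)

lemma act_add: "act g (v + w) = act g v + act g w"
  by (rule ext) (simp add: act_def fun_apply)

lemma act_zero [simp]: "act g 0 = 0"
  by (rule ext) (simp add: act_def fun_apply)

lemma act_comp: "g \<in> \<Gamma> \<Longrightarrow> h \<in> \<Gamma> \<Longrightarrow> act (g \<circ> h) w = act g (act h w)"
  by (simp add: act_def o_inv_distrib o_assoc)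

lemma act_cancel [simp]: "g \<in> \<Gamma> \<Longrightarrow> act g (act (inv' g) w) = w" "g \<in> \<Gamma> \<Longrightarrow> act (inv' g) (act g w) = w"
  by (simp_all flip: act_comp)

lemma act_eqI:
  assumes "g \<in> \<Gamma>" "\<And>i. v (g i) = w i"
  shows "v = act g w"
proof
  fix i show "v i = act g w i"
    using assms(2)[of "inv' g i"] assms(1) by (simp add: act_def)
qed

lemma sum_act:
  assumes "g \<in> \<Gamma>" "g ` A = A" shows "sum (act g w) A = sum w A"
proof -
  have "bij_betw g A A"
    using assms Gamma_bij bij_is_inj by (metis bij_betw_def inj_on_subset subset_UNIV)
  then have "sum (act g w) A = sum (\<lambda>i. act g w (g i)) A"
    by (rule sum.reindex_bij_betw [symmetric])
  then show ?thesis using assms(1) by (simp add: act_apply)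
qed

lemma evens_add [simp]: "v \<in> evens \<Longrightarrow> w \<in> evens \<Longrightarrow> v + w \<in> evens"
  by (simp add: evens_def sum.distrib fun_apply)

lemma evens_zero [simp]: "0 \<in> evens"
  by (simp add: evens_def fun_apply)

lemma evens_act [simp]:
  assumes "w \<in> evens" "g \<in> \<Gamma>" shows "act g w \<in> evens"
proof -
  have "act g w i = 0" if "i \<notin> {1..12}" for i
    using assms that Gamma_outside[OF inv_Gamma] by (simp add: act_def evens_def)
  then show ?thesis
    using assms by (simp add: evens_def sum_act Gamma_points Gamma_totals)
qed

lemma comm_conj:
  assumes "comm w g" "g \<in> \<Gamma>" "h \<in> \<Gamma>"
  shows "comm (act h w) (h \<circ> g \<circ> inv' h)"
proof -
  obtain s t a b where st: "s \<in> evens" "t \<in> evens" "a \<in> \<Gamma>" "b \<in> \<Gamma>"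
    and ab: "g \<circ> b \<circ> a = a \<circ> b" and w: "w + act g t + act (g \<circ> b) s = s + act a t"
    using assms(1) unfolding comm_def by blast
  let ?c = "\<lambda>x. h \<circ> x \<circ> inv' h"
  have cc: "?c x \<circ> ?c y = ?c (x \<circ> y)" for x y
    using assms(3) by (auto simp: fun_eq_iff)
  have ac: "act (?c x) (act h v) = act h (act x v)" if "x \<in> \<Gamma>" for x v
    using assms(3) that by (simp add: act_comp)
  show ?thesis unfolding comm_def
  proof (intro bexI conjI)
    show "?c g \<circ> ?c b \<circ> ?c a = ?c a \<circ> ?c b"
      unfolding cc ab ..
    have "act h (w + act g t + act (g \<circ> b) s) = act h (s + act a t)" by (simp only: w)
    then show "act h w + act (?c g) (act h t) + act (?c g \<circ> ?c b) (act h s) =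
        act h s + act (?c a) (act h t)"
      unfolding cc using assms st by (simp add: ac act_add)
  qed (use st assms in auto)
qed

text \<open>The commutator \<open>[(s', a), (t', c')]\<close> with \<open>a = c b\<^sup>-\<^sup>1 c\<^sup>-\<^sup>1\<close> and
  \<open>c' = c b c\<^sup>-\<^sup>1 b\<^sup>-\<^sup>1 c\<^sup>-\<^sup>1\<close> has \<open>A6\<close>-part \<open>[b, c]\<close>; varying \<open>s'\<close> and \<open>t'\<close>,
  its vector part runs through the augmentation \<open>(1 + b) V + (1 + c) V\<close>.\<close>

definition aug :: "(nat \<Rightarrow> nat) \<Rightarrow> (nat \<Rightarrow> nat) \<Rightarrow> (nat \<Rightarrow> bit) set" where
  "aug b c = {s + act b s + (t + act c t) | s t. s \<in> evens \<and> t \<in> evens}"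

lemma comm_aug:
  assumes "b \<in> \<Gamma>" "c \<in> \<Gamma>" "r \<in> \<Gamma>" "r \<circ> c \<circ> b = b \<circ> c" "w \<in> aug b c"
  shows "comm w r"
proof -
  obtain s t where st: "s \<in> evens" "t \<in> evens" and w: "w = s + act b s + (t + act c t)"
    using assms(5) by (auto simp: aug_def)
  define B C where "B = inv' b" and "C = inv' c"
  have BC [simp]: "B \<in> \<Gamma>" "C \<in> \<Gamma>" "b (B i) = i" "B (b i) = i" "c (C i) = i" "C (c i) = i" for i
    using assms by (simp_all add: B_def C_def)
  have "r i = (r \<circ> c \<circ> b) (B (C i))" for i by simp
  then have r: "r = b \<circ> c \<circ> B \<circ> C" unfolding assms(4) by auto
  let ?a = "c \<circ> B \<circ> C" and ?b = "c \<circ> b \<circ> C \<circ> B \<circ> C"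
  have "r \<circ> ?b = C" "?a \<circ> (c \<circ> b \<circ> C) = id" "r \<circ> (c \<circ> b \<circ> C) = b" "C \<circ> c = id"
    by (auto simp: r fun_eq_iff)
  \<comment> \<open>With s' = c t and t' = c b c^-1 s, the four translates in the commutator
    equation become s, b s, t and c t, whose sum is w.\<close>
  then have *: "act (r \<circ> ?b) (act c t) = t"
    "act ?a (act (c \<circ> b \<circ> C) s) = s" "act r (act (c \<circ> b \<circ> C) s) = act b s"
    using assms(1-3) by (simp_all flip: act_comp)
  show ?thesis unfolding comm_def
  proof (intro bexI conjI)
    show "r \<circ> ?b \<circ> ?a = ?a \<circ> ?b" by (simp add: r fun_eq_iff)
    show "w + act r (act (c \<circ> b \<circ> C) s) + act (r \<circ> ?b) (act c t) =
        act c t + act ?a (act (c \<circ> b \<circ> C) s)"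
      unfolding * by (simp add: w ac_simps)
  qed (use st assms in simp_all)
qed

section \<open>Edges, walks and lower bounds for the augmentation\<close>

definition edge :: "nat \<Rightarrow> nat \<Rightarrow> nat \<Rightarrow> bit" where
  "edge i j k = (if k = i then 1 else 0) + (if k = j then 1 else 0)"

lemma edge_commute: "edge i j = edge j i"
  by (rule ext) (simp add: edge_def add.commute)

lemma edge_trans: "edge i j + edge j k = edge i k"
  by (rule ext) (simp add: edge_def fun_apply ac_simps)

lemma edge_self [simp]: "edge i i = 0"
  by (rule ext) (simp add: edge_def fun_apply)

lemma act_edge: "g \<in> \<Gamma> \<Longrightarrow> act g (edge i j) = edge (g i) (g j)"
  by (rule act_eqI [symmetric]) (auto simp: edge_def Gamma_eq_iff)

lemma edge_evens:
  assumes "i \<in> A" "j \<in> A" "A = points \<or> A = totals" shows "edge i j \<in> evens"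
proof -
  have "sum (edge i j) B = 0" if "finite B" "i \<in> B \<longleftrightarrow> j \<in> B" for B
    using that unfolding edge_def sum.distrib by (simp only: sum.delta) auto
  moreover have "edge i j k = 0" if "k \<notin> {1..12}" for k
    using assms that by (auto simp: edge_def)
  moreover have "i \<in> points \<longleftrightarrow> j \<in> points" "i \<in> totals \<longleftrightarrow> j \<in> totals"
    using assms by auto
  ultimately show ?thesis unfolding evens_def by blast
qed

lemma augI: "s \<in> evens \<Longrightarrow> t \<in> evens \<Longrightarrow> s + act b s + (t + act c t) \<in> aug b c"
  unfolding aug_def by blast

lemma aug_add: "v \<in> aug b c \<Longrightarrow> w \<in> aug b c \<Longrightarrow> v + w \<in> aug b c"
proof -
  assume "v \<in> aug b c" "w \<in> aug b c"
  then obtain s t s' t' where *: "s \<in> evens" "t \<in> evens" "s' \<in> evens" "t' \<in> evens"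
    "v = s + act b s + (t + act c t)" "w = s' + act b s' + (t' + act c t')"
    by (auto simp: aug_def)
  then have "v + w = (s + s') + act b (s + s') + ((t + t') + act c (t + t'))"
    by (simp add: act_add ac_simps)
  moreover have "s + s' \<in> evens" "t + t' \<in> evens" using * by simp_all
  ultimately show ?thesis unfolding aug_def by blast
qed

lemma aug_zero: "0 \<in> aug b c"
proof -
  have "0 = 0 + act b 0 + (0 + act c 0)" by simp
  then show ?thesis unfolding aug_def using evens_zero by blast
qed

text \<open>Telescoping, 1 + g h = (1 + h) + (1 + g) h. Products of copies of b and c thus provide
  further elements of the augmentation, which is essential when b or c itself has no fixed letter in
  a half.\<close>

lemma aug_moves:
  assumes "set gs \<subseteq> {b, c}" "w \<in> evens"
  shows "w + act (word (concat gs)) w \<in> aug (word b) (word c)"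
  using assms(1)
proof (induction gs)
  case Nil
  then show ?case by (simp only: concat.simps word.simps act_id fun_add_self aug_zero)
next
  case (Cons g gs)
  let ?v = "act (word (concat gs)) w"
  have v: "?v \<in> evens" using assms(2) by simp
  have "?v + act (word b) ?v \<in> aug (word b) (word c)" "?v + act (word c) ?v \<in> aug (word b) (word c)"
    using augI[OF v evens_zero, of "word b" "word c"] augI[OF evens_zero v, of "word b" "word c"]
    by simp_all
  then have "?v + act (word g) ?v \<in> aug (word b) (word c)"
    using Cons.prems by auto
  moreover have "w + ?v \<in> aug (word b) (word c)" using Cons by simp
  ultimately have "w + ?v + (?v + act (word g) ?v) \<in> aug (word b) (word c)"
    using aug_add by blast
  then show ?case
    unfolding concat.simps word_append act_comp[OF word_in_Gamma word_in_Gamma] by (simp add: add.assoc)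
qed

text \<open>If \<open>g\<close> fixes \<open>k\<close>, then \<open>1 + g\<close> maps \<open>edge i k\<close> to \<open>edge i (g i)\<close>.\<close>

lemma aug_edge:
  assumes "set gs \<subseteq> {b, c}" "A = points \<or> A = totals" "i \<in> A" "k \<in> A"
    "word (concat gs) k = k"
  shows "edge i (word (concat gs) i) \<in> aug (word b) (word c)"
proof -
  let ?g = "word (concat gs)"
  have "edge i k + act ?g (edge i k) \<in> aug (word b) (word c)"
    using aug_moves[OF assms(1) edge_evens[OF assms(3,4,2)]] .
  then have "edge i k + edge (?g i) k \<in> aug (word b) (word c)"
    by (simp add: act_edge assms(5))
  then show ?thesis using edge_trans[of i k "?g i"] by (simp add: edge_commute)
qed

text \<open>Consecutive edges add up by \<open>edge_trans\<close>. The equation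
  \<open>xs = a # ys\<close> only names the starting letter; a walk may revisit letters.\<close>

lemma aug_walk:
  assumes "successively (\<lambda>i j. edge i j \<in> aug b c) xs" "i \<in> set xs" "xs = a # ys"
  shows "edge a i \<in> aug b c"
  using assms
proof (induction ys arbitrary: xs a)
  case (Cons y ys)
  show ?case
  proof (cases "i = a")
    case False
    then have "edge y i \<in> aug b c" "edge a y \<in> aug b c" using Cons by auto
    then show ?thesis using aug_add edge_trans by metis
  qed (simp add: aug_zero)
qed (simp add: aug_zero)

definition restr :: "nat set \<Rightarrow> (nat \<Rightarrow> bit) \<Rightarrow> nat \<Rightarrow> bit" where
  "restr A w i = (if i \<in> A then w i else 0)"

lemma aug_sum: "finite A \<Longrightarrow> (\<And>i. i \<in> A \<Longrightarrow> f i \<in> aug b c) \<Longrightarrow> sum f A \<in> aug b c"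
  by (induction rule: finite_induct) (auto simp: aug_zero aug_add)

lemma sum_fun_apply: "sum f A k = (\<Sum>i\<in>A. f i k)" for f :: "nat \<Rightarrow> nat \<Rightarrow> bit"
  by (induction A rule: infinite_finite_induct) (auto simp: fun_apply)

text \<open>Each letter i with w i = 1 contributes an edge e_a + e_i from the first letter a of the
  walk. The number of these letters is even, so the terms e_a cancel and the restriction of w
  remains.\<close>

lemma aug_restr:
  assumes "successively (\<lambda>i j. edge i j \<in> aug b c) xs" "sum w (set xs) = 0"
  shows "restr (set xs) w \<in> aug b c"
proof (cases xs)
  case Nil
  then show ?thesis using aug_zero by (simp add: restr_def[abs_def] zero_fun_def)
next
  case (Cons a ys)
  have "restr (set xs) w = (\<Sum>i\<in>set xs. if w i = 1 then edge a i else 0)"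
  proof
    fix k
    have "(\<Sum>i\<in>set xs. if w i = 1 then edge a i else 0) k =
        (\<Sum>i\<in>set xs. (if k = a then w i else 0) + (if k = i then w i else 0))"
      unfolding sum_fun_apply by (rule sum.cong) (auto simp: edge_def fun_apply)
    also have "\<dots> = (if k = a then sum w (set xs) else 0) + (if k \<in> set xs then w k else 0)"
      by (auto simp: sum.distrib)
    also have "\<dots> = restr (set xs) w k"
      using assms(2) by (simp add: restr_def)
    finally show "restr (set xs) w k = (\<Sum>i\<in>set xs. if w i = 1 then edge a i else 0) k" ..
  qed
  moreover have "(\<Sum>i\<in>set xs. if w i = 1 then edge a i else 0) \<in> aug b c"
    by (rule aug_sum) (use aug_walk[OF assms(1) _ Cons] aug_zero in auto)
  ultimately show ?thesis by simp
qed

text \<open>The letter sets of the walks partition the twelve letters, so w is the sum of its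
  restrictions. A letter that no edge reaches forms a walk of its own; the condition on sums then
  says that w vanishes there.\<close>

lemma aug_walks:
  assumes "w \<in> evens"
    and walks: "\<forall>xs\<in>set walks. successively (\<lambda>i j. edge i j \<in> aug b c) xs \<and> sum w (set xs) = 0"
    and once: "\<forall>i\<in>{1..12}. length (filter (\<lambda>xs. i \<in> set xs) walks) = 1"
  shows "w \<in> aug b c"
proof -
  have "sum_list (map (\<lambda>xs. restr (set xs) w) walks) \<in> aug b c"
    using walks by (induction walks) (auto simp: aug_zero aug_add aug_restr)
  moreover have "sum_list (map (\<lambda>xs. restr (set xs) w) walks) k =
      of_nat (length (filter (\<lambda>xs. k \<in> set xs) walks)) * w k" for k
    by (induction walks) (auto simp: restr_def fun_apply algebra_simps)
  moreover have "of_nat (length (filter (\<lambda>xs. k \<in> set xs) walks)) * w k = w k" for k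
  proof (cases "k \<in> {1..12}")
    case True
    then have "length (filter (\<lambda>xs. k \<in> set xs) walks) = 1" using once by blast
    then show ?thesis by (simp only: of_nat_1 mult_1)
  next
    case False
    then have "w k = 0" using assms(1) by (simp add: evens_def)
    then show ?thesis by simp
  qed
  ultimately have "sum_list (map (\<lambda>xs. restr (set xs) w) walks) \<in> aug b c"
    "sum_list (map (\<lambda>xs. restr (set xs) w) walks) = w"
    by (simp_all add: fun_eq_iff)
  then show ?thesis by simp
qed

subsection \<open>Nontrivial permutations\<close>

text \<open>The hypothesis of \<open>aug_edge\<close>, namely a letter fixed by g in the half
  containing i, spelled out with explicit sets so that it can be evaluated at numerals.\<close>

definition edge_of :: "(nat \<Rightarrow> nat) \<Rightarrow> nat \<Rightarrow> nat \<Rightarrow> bool" where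
  "edge_of g i j \<longleftrightarrow>
     (if i \<le> 6 then 1 \<le> i \<and> (\<exists>k\<in>{1, 2, 3, 4, 5, 6}. g k = k)
      else i \<le> 12 \<and> (\<exists>k\<in>{7, 8, 9, 10, 11, 12}. g k = k))
     \<and> j = g i"

lemma aug_edge_of:
  assumes "edge_of (word (concat gs)) i j" "set gs \<subseteq> {b, c}"
  shows "edge i j \<in> aug (word b) (word c)"
proof (cases "i \<le> 6")
  case True
  from assms(1) obtain k where "k \<in> {1, 2, 3, 4, 5, 6}" "word (concat gs) k = k" "1 \<le> i"
    "j = word (concat gs) i"
    unfolding edge_of_def if_P[OF True] by blast
  with True show ?thesis using aug_edge[OF assms(2), of points i k] unfolding points_eq[symmetric] by simp
next
  case False
  from assms(1) obtain k where "k \<in> {7, 8, 9, 10, 11, 12}" "word (concat gs) k = k" "i \<le> 12"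
    "j = word (concat gs) i"
    unfolding edge_of_def if_not_P[OF False] by blast
  with False show ?thesis using aug_edge[OF assms(2), of totals i k] unfolding totals_eq[symmetric] by simp
qed

text \<open>The format of all certificates below. \<open>eq\<close> says r c b = b c, hence r =
  [b, c], at four points, which is enough by \<open>Gamma_eq_four\<close>; \<open>gs\<close> lists
  the products of b and c that supply edges, usable in both directions; \<open>walks\<close> are
  routes along these edges.\<close>

lemma comm_by_walks:
  assumes "w \<in> evens"
    and eq: "\<forall>i\<in>{1, 2, 3, 4}. word (r @ c @ b) i = word (b @ c) i"
    and gs: "\<forall>g\<in>set gs. set g \<subseteq> {b, c}"
    and walks: "\<forall>xs\<in>set walks. sum w (set xs) = 0 \<and>
      successively (\<lambda>i j. \<exists>g\<in>set gs. edge_of (word (concat g)) i j \<or> edge_of (word (concat g)) j i) xs"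
    and once: "\<forall>i\<in>set [1..<13]. length (filter (\<lambda>xs. i \<in> set xs) walks) = 1"
  shows "comm w (word r)"
proof (rule comm_aug)
  show "word r \<circ> word c \<circ> word b = word b \<circ> word c"
    using eq by (intro Gamma_eq_four) (simp_all add: word_append)
  show "w \<in> aug (word b) (word c)"
  proof (rule aug_walks[OF assms(1)])
    show "\<forall>xs\<in>set walks. successively (\<lambda>i j. edge i j \<in> aug (word b) (word c)) xs \<and> sum w (set xs) = 0"
    proof (intro ballI conjI)
      fix xs assume xs: "xs \<in> set walks"
      show "sum w (set xs) = 0" using walks xs by blast
      have "edge i j \<in> aug (word b) (word c)"
        if "\<exists>g\<in>set gs. edge_of (word (concat g)) i j \<or> edge_of (word (concat g)) j i" for i j
        using that gs aug_edge_of by (metis edge_commute)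
      then show "successively (\<lambda>i j. edge i j \<in> aug (word b) (word c)) xs"
        using walks xs by (blast intro: successively_mono)
    qed
    show "\<forall>i\<in>{1..12}. length (filter (\<lambda>xs. i \<in> set xs) walks) = 1"
    proof
      fix i :: nat assume "i \<in> {1..12}"
      then have "i \<in> set [1..<13]" unfolding set_upt by simp
      then show "length (filter (\<lambda>xs. i \<in> set xs) walks) = 1" using once by blast
    qed
  qed
qed simp_all

lemma evens_sums:
  assumes "w \<in> evens"
  shows "w 1 + w 2 + w 3 + w 4 + w 5 + w 6 = 0" "w 7 + w 8 + w 9 + w 10 + w 11 + w 12 = 0"
  using assms unfolding evens_def points_eq totals_eq by (simp_all add: add.assoc)

text \<open>The name gives the cycles of the word on points. Here and in the next five lemmas b and
  c have order 5 and their fixed letters differ in each half: each joins five letters of the half,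
  and together they join all six, so one walk per half suffices.\<close>

lemma comm_1234_56:
  assumes "w \<in> evens" shows "comm w (word [S,E])"
  by (rule comm_by_walks[OF assms(1), where b = "[E,E,S,S,E]" and c = "[S,S,S]"
        and gs = "[[[E,E,S,S,E]], [[S,S,S]]]"
        and walks = "[[5, 2, 6, 1, 3, 4], [11, 8, 10, 12, 9, 7]]"])
    (use evens_sums[OF assms(1)] in \<open>simp_all add: edge_of_def upt_rec ac_simps\<close>)

lemma comm_12345:
  assumes "w \<in> evens" shows "comm w (word [S])"
  by (rule comm_by_walks[OF assms(1), where b = "[E,S,E,S,S,S,E]" and c = "[E,E,S,S,S,E,S]"
        and gs = "[[[E,S,E,S,S,S,E]], [[E,E,S,S,S,E,S]]]"
        and walks = "[[1, 4, 5, 6, 3, 2], [10, 12, 11, 7, 9, 8]]"])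
    (use evens_sums[OF assms(1)] in \<open>simp_all add: edge_of_def upt_rec ac_simps\<close>)

lemma comm_12346:
  assumes "w \<in> evens" shows "comm w (word [S,E,E])"
  by (rule comm_by_walks[OF assms(1), where b = "[S,S,E,S,S]" and c = "[E,S,S,E,S]"
        and gs = "[[[S,S,E,S,S]], [[E,S,S,E,S]]]"
        and walks = "[[2, 3, 6, 1, 5, 4], [10, 8, 9, 12, 11, 7]]"])
    (use evens_sums[OF assms(1)] in \<open>simp_all add: edge_of_def upt_rec ac_simps\<close>)

lemma comm_12_34:
  assumes "w \<in> evens" shows "comm w (word [S,S,E,S,E,E,S,E,S])"
  by (rule comm_by_walks[OF assms(1), where b = "[E,E,S]" and c = "[S,E,E,S,S,S,E,S]"
        and gs = "[[[E,E,S]], [[S,E,E,S,S,S,E,S]]]"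
        and walks = "[[4, 3, 6, 5, 1, 2], [7, 8, 12, 11, 10, 9]]"])
    (use evens_sums[OF assms(1)] in \<open>simp_all add: edge_of_def upt_rec ac_simps\<close>)

lemma comm_12_3456:
  assumes "w \<in> evens" shows "comm w (word [E,S,S,E,S,E,E,S,S])"
  by (rule comm_by_walks[OF assms(1), where b = "[S,S,S,S]" and c = "[E,S,S,E,E]"
        and gs = "[[[S,S,S,S]], [[E,S,S,E,E]]]"
        and walks = "[[6, 3, 2, 1, 5, 4], [12, 11, 10, 9, 8, 7]]"])
    (use evens_sums[OF assms(1)] in \<open>simp_all add: edge_of_def upt_rec ac_simps\<close>)

lemma comm_12_3465:
  assumes "w \<in> evens" shows "comm w (word [E,S,S,E,S,E,E,S,S,E])"
  by (rule comm_by_walks[OF assms(1), where b = "[S,S,E,S,E,E,S]" and c = "[S,S]"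
        and gs = "[[[S,S,E,S,E,E,S]], [[S,S]]]"
        and walks = "[[2, 5, 4, 6, 3, 1], [7, 9, 8, 11, 12, 10]]"])
    (use evens_sums[OF assms(1)] in \<open>simp_all add: edge_of_def upt_rec ac_simps\<close>)

text \<open>For an element of order 3 no suitable pair generates \<open>A\<^sub>6\<close>: in each case below, the pair
  generates \<open>A\<^sub>5\<close> (fixing one letter) or \<open>S\<^sub>4\<close> (stabilizing a pair of letters).\<close>

lemma comm_123_fix6:
  assumes "w \<in> evens" "w 6 = 0" shows "comm w (word [S,S,E,S,E,S,S])"
  by (rule comm_by_walks[OF assms(1), where b = "[E,S,E,E,S,E]" and c = "[S,S,S]"
        and gs = "[[[E,S,E,E,S,E]], [[S,S,S]]]"
        and walks = "[[1, 3, 4, 2, 5], [6], [10, 7, 9, 12, 11, 8]]"])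
    (use evens_sums[OF assms(1)] assms(2) in \<open>simp_all add: edge_of_def upt_rec ac_simps\<close>)

lemma comm_123_fix5:
  assumes "w \<in> evens" "w 5 = 0" shows "comm w (word [S,S,E,S,E,S,S])"
  by (rule comm_by_walks[OF assms(1), where b = "[S,E,E,S,E,E]" and c = "[E,E,S,S,S,E]"
        and gs = "[[[S,E,E,S,E,E]], [[E,E,S,S,S,E]]]"
        and walks = "[[1, 3, 6, 2, 4], [5], [8, 7, 10, 12, 11, 9]]"])
    (use evens_sums[OF assms(1)] assms(2) in \<open>simp_all add: edge_of_def upt_rec ac_simps\<close>)

lemma comm_123_pair:
  assumes "w \<in> evens" "w 5 = w 6" shows "comm w (word [S,S,E,S,E,S,S])"
  \<comment> \<open>On points b = (1 2)(5 6) and c = (1 2 3 4)(5 6). Since c has cycle type 4 + 2 on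
    both halves, it fixes no letter and supplies no edge itself; its square and the conjugate c b
    c^3 of b do.\<close>
  by (rule comm_by_walks[OF assms(1), where b = "[S,E,E,S,E,S,S,S]" and c = "[S,E]"
        and gs = "[[[S,E,E,S,E,S,S,S]], [[S,E], [S,E]], [[S,E], [S,E,E,S,E,S,S,S], [S,E], [S,E], [S,E]]]"
        and walks = "[[3, 1, 2, 4], [5, 6], [7, 8, 12, 9, 11, 10]]"])
    (use evens_sums[OF assms(1)] assms(2) in \<open>simp_all add: edge_of_def upt_rec ac_simps\<close>)

text \<open>The picture for (1 2 3) with points and totals exchanged: this element acts on totals as
  a 3-cycle, and the exceptional letters 7 and 8 are two of the totals that it fixes.\<close>

lemma comm_123_456_fix8:
  assumes "w \<in> evens" "w 8 = 0" shows "comm w (word [E,S,S,E,S,E,S,S])"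
  by (rule comm_by_walks[OF assms(1), where b = "[S,E,E,S,E,S,S]" and c = "[S,E,E]"
        and gs = "[[[S,E,E,S,E,S,S]], [[S,E,E]]]"
        and walks = "[[2, 1, 6, 5, 4, 3], [7, 11, 10, 12, 9], [8]]"])
    (use evens_sums[OF assms(1)] assms(2) in \<open>simp_all add: edge_of_def upt_rec ac_simps\<close>)

lemma comm_123_456_fix7:
  assumes "w \<in> evens" "w 7 = 0" shows "comm w (word [E,S,S,E,S,E,S,S])"
  by (rule comm_by_walks[OF assms(1), where b = "[S,S,E,S,E,E,S]" and c = "[E,E,S]"
        and gs = "[[[S,S,E,S,E,E,S]], [[E,E,S]]]"
        and walks = "[[2, 1, 5, 4, 6, 3], [8, 11, 12, 10, 9], [7]]"])
    (use evens_sums[OF assms(1)] assms(2) in \<open>simp_all add: edge_of_def upt_rec ac_simps\<close>)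

lemma comm_123_456_pair:
  assumes "w \<in> evens" "w 7 = w 8" shows "comm w (word [E,S,S,E,S,E,S,S])"
  by (rule comm_by_walks[OF assms(1), where b = "[S,S,E,S]" and c = "[S,E,E,S,E,S,S,S]"
        and gs = "[[[S,S,E,S]], [[S,E,E,S,E,S,S,S]], [[S,S,E,S], [S,E,E,S,E,S,S,S], [S,S,E,S], [S,S,E,S]], [[S,S,E,S], [S,S,E,S], [S,E,E,S,E,S,S,S], [S,S,E,S]]]"
        and walks = "[[5, 6, 3, 1, 2, 4], [7, 8], [9, 12, 10, 11]]"])
    (use evens_sums[OF assms(1)] assms(2) in \<open>simp_all add: edge_of_def upt_rec ac_simps\<close>)

lemma comm_123_465_fix12:
  assumes "w \<in> evens" "w 12 = 0" shows "comm w (word [E,E,S,S,E,S,E,S,S])"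
  by (rule comm_by_walks[OF assms(1), where b = "[S,S,S,E,S,S,E]" and c = "[S]"
        and gs = "[[[S,S,S,E,S,S,E]], [[S]]]"
        and walks = "[[1, 2, 3, 6, 4, 5], [7, 10, 9, 8, 11], [12]]"])
    (use evens_sums[OF assms(1)] assms(2) in \<open>simp_all add: edge_of_def upt_rec ac_simps\<close>)

lemma comm_123_465_fix11:
  assumes "w \<in> evens" "w 11 = 0" shows "comm w (word [E,E,S,S,E,S,E,S,S])"
  by (rule comm_by_walks[OF assms(1), where b = "[E,E,S,S,S,S,E]" and c = "[S,S,S,E,S]"
        and gs = "[[[E,E,S,S,S,S,E]], [[S,S,S,E,S]]]"
        and walks = "[[5, 1, 4, 6, 3, 2], [7, 10, 9, 8, 12], [11]]"])
    (use evens_sums[OF assms(1)] assms(2) in \<open>simp_all add: edge_of_def upt_rec ac_simps\<close>)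

lemma comm_123_465_pair:
  assumes "w \<in> evens" "w 11 = w 12" shows "comm w (word [E,E,S,S,E,S,E,S,S])"
  \<comment> \<open>The first walk makes a detour from 4 to 6 and back. The duplicate 4 disappears
    from its letter set after \<open>insert_commute[of 6 4]\<close>.\<close>
  by (rule comm_by_walks[OF assms(1), where b = "[S,S,E]" and c = "[S,S,S,E,S,E,E,S]"
        and gs = "[[[S,S,S,E,S,E,E,S]], [[S,S,E], [S,S,S,E,S,E,E,S], [S,S,E], [S,S,E], [S,S,E]], [[S,S,E], [S,S,E], [S,S,S,E,S,E,E,S], [S,S,E], [S,S,E]]]"
        and walks = "[[1, 2, 3, 4, 6, 4, 5], [8, 7, 10, 9], [11, 12]]"])
    (use evens_sums[OF assms(1)] assms(2) in \<open>simp_all add: edge_of_def upt_rec ac_simps insert_commute[of 6 4]\<close>)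

text \<open>The three lines x = 0, y = 0 and x + y = 0 cover the plane over the field with two
  elements. This is why two subgroups A5 and one S4, each reaching only a hyperplane of V, together
  reach everything.\<close>

lemma bit_not_both: "x = 0 \<or> y = 0 \<or> x = y" for x y :: bit
  by (cases x; cases y) simp_all

lemma comm_123: "w \<in> evens \<Longrightarrow> comm w (word [S,S,E,S,E,S,S])"
  using bit_not_both[of "w 6" "w 5"] comm_123_fix6 comm_123_fix5 comm_123_pair by metis

lemma comm_123_456: "w \<in> evens \<Longrightarrow> comm w (word [E,S,S,E,S,E,S,S])"
  using bit_not_both[of "w 8" "w 7"] comm_123_456_fix8 comm_123_456_fix7 comm_123_456_pair by metis

lemma comm_123_465: "w \<in> evens \<Longrightarrow> comm w (word [E,E,S,S,E,S,E,S,S])"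
  using bit_not_both[of "w 12" "w 11"] comm_123_465_fix12 comm_123_465_fix11 comm_123_465_pair by metis

text \<open>All elements that send 1 to 2 and the pair 2, 3 to 1, 4 or 3, 1 or 3, 4; each pattern
  leaves three values for 4. The six nontrivial classes of A6 are covered with repetitions, which
  keeps the normalization in \<open>Gamma_conj_rep\<close> simple.\<close>

definition class_reps :: "letter list set" where
  "class_reps = {[S,E], [S], [S,E,E], [S,S,E,S,E,E,S,E,S], [E,S,S,E,S,E,E,S,S], [E,S,S,E,S,E,E,S,S,E],
     [S,S,E,S,E,S,S], [E,S,S,E,S,E,S,S], [E,E,S,S,E,S,E,S,S]}"

lemma comm_class_reps: "w \<in> evens \<Longrightarrow> xs \<in> class_reps \<Longrightarrow> comm w (word xs)"
  unfolding class_reps_def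
  using comm_1234_56 comm_12345 comm_12346 comm_12_34 comm_12_3456 comm_12_3465
    comm_123 comm_123_456 comm_123_465 by blast

lemma Gamma_rep:
  assumes "g \<in> \<Gamma>" "g 1 = 2" "g 2 = 1 \<and> g 3 = 4 \<or> g 2 = 3 \<and> (g 3 = 1 \<or> g 3 = 4)"
  shows "\<exists>xs\<in>class_reps. g = word xs"
proof -
  have "g 4 \<in> points" using Gamma_in_points[OF assms(1)] by simp
  moreover have "g 4 \<noteq> g 1" "g 4 \<noteq> g 2" "g 4 \<noteq> g 3"
    using assms(1) by (simp_all add: Gamma_eq_iff)
  ultimately have "\<exists>xs\<in>class_reps. g 1 = word xs 1 \<and> g 2 = word xs 2 \<and> g 3 = word xs 3 \<and> g 4 = word xs 4"
    using assms(2,3) unfolding points_eq class_reps_def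
    by (elim disjE conjE insertE emptyE) simp_all
  then show ?thesis using Gamma_eq_four[OF assms(1)] word_in_Gamma by blast
qed

text \<open>A moved point a and its image become 1 and 2; c and d are chosen along the cycles of g
  so that the relabelled permutation has one of the patterns of \<open>Gamma_rep\<close>. Fourfold
  transitivity performs the relabelling inside A6.\<close>

lemma Gamma_conj_rep:
  assumes g: "g \<in> \<Gamma>" and "g \<noteq> id"
  obtains h xs where "h \<in> \<Gamma>" "xs \<in> class_reps" "g = h \<circ> word xs \<circ> inv' h"
proof -
  have "\<exists>a\<in>points. g a \<noteq> a"
  proof (rule ccontr)
    assume "\<not> ?thesis"
    then have "g = id" using Gamma_eq_points[OF g id_Gamma] by simp
    with assms show False by simp
  qed
  then obtain a where a: "a \<in> points" "g a \<noteq> a" by blast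
  have "\<exists>c d. {a, g a, c, d} \<subseteq> points \<and> distinct [a, g a, c, d] \<and>
    (g (g a) = a \<and> g c = d \<or> g (g a) = c \<and> (g c = a \<or> g c = d))"
  proof (cases "g (g a) = a")
    case True
    \<comment> \<open>A transposition is impossible: if the other four points were fixed, g would
      agree with the identity on four points and hence be trivial.\<close>
    have "\<exists>c\<in>points. c \<noteq> a \<and> c \<noteq> g a \<and> g c \<noteq> c"
    proof (rule ccontr)
      assume "\<not> ?thesis"
      then have fixed: "g c = c" if "c \<in> points" "c \<noteq> a" "c \<noteq> g a" for c using that by blast
      have "card (points - {a, g a}) = 4"
        using a Gamma_in_points[OF g a(1)] by (simp add: card_Diff_subset)
      then obtain cs where cs: "set cs = points - {a, g a}" "distinct cs" "length cs = 4"
        using finite_distinct_list[of "points - {a, g a}"] distinct_card by (metis finite_Diff finite_atLeastAtMost)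
      then obtain c1 c2 c3 c4 where cs': "cs = [c1, c2, c3, c4]"
        by (auto simp: numeral_eq_Suc length_Suc_conv)
      then have cp: "{c1, c2, c3, c4} \<subseteq> points - {a, g a}" using cs by auto
      moreover have "distinct [c1, c2, c3, c4]" using cs cs' by simp
      ultimately obtain h where h: "h \<in> \<Gamma>" "h 1 = c1" "h 2 = c2" "h 3 = c3" "h 4 = c4"
        using four_transitive[of c1 c2 c3 c4] by blast
      have "g \<circ> h = h"
        by (rule Gamma_eq_four) (use g h(1) fixed cp in \<open>simp_all add: h(2-5)\<close>)
      then have "g = id" using inv_Gamma_cancel(1)[OF h(1)] by (metis comp_id o_assoc)
      with assms show False by simp
    qed
    then obtain c where c: "c \<in> points" "c \<noteq> a" "c \<noteq> g a" "g c \<noteq> c" by blast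
    then have "g c \<noteq> a" "g c \<noteq> g a" using True Gamma_eq_iff[OF g] by metis+
    then have "distinct [a, g a, c, g c]" using a(2) c by simp
    moreover have "{a, g a, c, g c} \<subseteq> points"
      using a(1) c(1) Gamma_in_points[OF g] by blast
    ultimately show ?thesis using True by blast
  next
    case False
    let ?c = "g (g a)"
    have ne: "?c \<noteq> g a" "g ?c \<noteq> g a" "g ?c \<noteq> ?c" using a False Gamma_eq_iff[OF g] by metis+
    have in_points: "g a \<in> points" "?c \<in> points" "g ?c \<in> points" using a Gamma_in_points[OF g] by blast+
    show ?thesis
    proof (cases "g ?c = a")
      case True
      \<comment> \<open>When a lies in a 3-cycle, any point outside that cycle can take the place of
        4.\<close>
      have "\<not> points \<subseteq> {a, g a, ?c}"
      proof
        assume "points \<subseteq> {a, g a, ?c}"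
        then have "card points \<le> card {a, g a, ?c}" by (intro card_mono) auto
        also have "\<dots> \<le> 3" by (simp add: card_insert_if)
        finally show False by simp
      qed
      then obtain d where "d \<in> points" "d \<notin> {a, g a, ?c}" by blast
      then have "distinct [a, g a, ?c, d]" "{a, g a, ?c, d} \<subseteq> points"
        using a ne False in_points by (simp, blast)
      then show ?thesis using True by blast
    next
      case *: False
      then have "distinct [a, g a, ?c, g ?c]" "{a, g a, ?c, g ?c} \<subseteq> points"
        using a ne False in_points by (simp, blast)
      then show ?thesis by blast
    qed
  qed
  then obtain c d where cd: "{a, g a, c, d} \<subseteq> points" "distinct [a, g a, c, d]"
    "g (g a) = a \<and> g c = d \<or> g (g a) = c \<and> (g c = a \<or> g c = d)" by blast
  then obtain h where h: "h \<in> \<Gamma>" "h 1 = a" "h 2 = g a" "h 3 = c" "h 4 = d"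
    using four_transitive by blast
  let ?k = "inv' h \<circ> g \<circ> h"
  have inv_h: "inv' h a = 1" "inv' h (g a) = 2" "inv' h c = 3" "inv' h d = 4"
    using inv_Gamma_cancel(3)[OF h(1)] h(2-5) by metis+
  have "\<exists>xs\<in>class_reps. ?k = word xs"
  proof (rule Gamma_rep)
    show "?k \<in> \<Gamma>" using g h(1) by simp
    show "?k 1 = 2" using inv_h h(2) by simp
    show "?k 2 = 1 \<and> ?k 3 = 4 \<or> ?k 2 = 3 \<and> (?k 3 = 1 \<or> ?k 3 = 4)"
      using cd(3) inv_h h by auto
  qed
  then obtain xs where xs: "xs \<in> class_reps" "?k = word xs" by blast
  have "g = h \<circ> ?k \<circ> inv' h" using h(1) by (simp add: fun_eq_iff)
  then show ?thesis using that h(1) xs by metis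
qed

lemma comm_nontrivial:
  assumes "w \<in> evens" "g \<in> \<Gamma>" "g \<noteq> id" shows "comm w g"
proof -
  obtain h xs where h: "h \<in> \<Gamma>" "xs \<in> class_reps" "g = h \<circ> word xs \<circ> inv' h"
    using Gamma_conj_rep[OF assms(2,3)] .
  then have "comm (act (inv' h) w) (word xs)" using assms(1) by (simp add: comm_class_reps)
  from comm_conj[OF this word_in_Gamma h(1)] show ?thesis using h by simp
qed

subsection \<open>The identity permutation\<close>

definition ind :: "nat set \<Rightarrow> nat \<Rightarrow> bit" where
  "ind A i = (if i \<in> A then 1 else 0)"

abbreviation ones :: "nat \<Rightarrow> bit" where "ones \<equiv> ind {1..12}"

lemma transitive_points:
  assumes "p \<in> points" obtains g where "g \<in> \<Gamma>" "g 6 = p"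
proof -
  have "\<exists>xs \<in> {[], [E], [S,E], [S,S,E], [S,S,S,E], [S,S,S,S,E]}. word xs 6 = p"
    using assms unfolding points_eq by (elim insertE emptyE) simp_all
  then show ?thesis using that word_in_Gamma by blast
qed

text \<open>The stabilizer of a point is an A5, which acts transitively on the six totals. Hence A6
  is transitive on pairs of a point and a total.\<close>

lemma transitive_totals:
  assumes "t \<in> totals" obtains g where "g \<in> \<Gamma>" "g 6 = 6" "g 12 = t"
proof -
  have "\<exists>xs \<in> {[], [E,S,E], [S,E,S,E], [S,S,E,S,E], [S,S,S,E,S,E], [E,S,E,E,S,E]}.
      word xs 6 = 6 \<and> word xs 12 = t"
    using assms unfolding totals_eq by (elim insertE emptyE) simp_all
  then show ?thesis using that word_in_Gamma by blast
qed

lemma rotate_points: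
  assumes "p \<in> {1, 2, 3, 4, 5}" obtains g where "g \<in> \<Gamma>" "g 6 = 6" "g 5 = p"
proof -
  have "\<exists>xs \<in> {[], [S], [S,S], [S,S,S], [S,S,S,S]}. word xs 6 = 6 \<and> word xs 5 = p"
    using assms by (elim insertE emptyE) simp_all
  then show ?thesis using that word_in_Gamma by blast
qed

lemma rotate_totals:
  assumes "t \<in> {7, 8, 9, 10, 11}" obtains g where "g \<in> \<Gamma>" "g 12 = 12" "g 11 = t"
proof -
  have "\<exists>xs \<in> {[], [S], [S,S], [S,S,S], [S,S,S,S]}. word xs 12 = 12 \<and> word xs 11 = t"
    using assms by (elim insertE emptyE) simp_all
  then show ?thesis using that word_in_Gamma by blast
qed

lemma act_inv_apply: "g \<in> \<Gamma> \<Longrightarrow> act (inv' g) w i = w (g i)"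
  by (simp add: act_def inv_inv_eq)

lemma comm_id_transfer:
  assumes "g \<in> \<Gamma>" "comm (act (inv' g) w) id" shows "comm w id"
  using comm_conj[OF assms(2) id_Gamma assms(1)] assms(1) by simp

text \<open>Taking b = c gives a trivial commutator of permutations. The 5-cycle connects all
  letters except its fixed letters 6 and 12, where w vanishes.\<close>

lemma comm_id_fix:
  assumes "w \<in> evens" "w 6 = 0" "w 12 = 0" shows "comm w (word [])"
  by (rule comm_by_walks[OF assms(1), where b = "[S]" and c = "[S]" and gs = "[[[S]]]"
        and walks = "[[1,2,3,4,5],[6],[7,8,9,10,11],[12]]"])
    (use evens_sums[OF assms(1)] assms(2,3) in \<open>simp_all add: edge_of_def upt_rec ac_simps\<close>)

text \<open>On points b = (1 5)(3 6) and c = (2 4)(3 6) generate a Klein four-group with three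
  orbits of length 2, on each of which two ones add up to 0. On totals it has one orbit of length 4
  and fixes 11 and 12. In the next lemma the halves are exchanged.\<close>

lemma comm_id_points:
  assumes "w \<in> evens" "w 1 = 1" "w 2 = 1" "w 3 = 1" "w 4 = 1" "w 5 = 1" "w 6 = 1" "w 11 = 0" "w 12 = 0"
  shows "comm w (word [])"
  by (rule comm_by_walks[OF assms(1), where b = "[S,S,E,S,S,E]" and c = "[E,S,E,S,S,E,E,S]"
        and gs = "[[[S,S,E,S,S,E]], [[E,S,E,S,S,E,E,S]]]"
        and walks = "[[1,5],[2,4],[3,6],[8,7,9,10],[11],[12]]"])
    (use evens_sums[OF assms(1)] assms(2-) in \<open>simp_all add: edge_of_def upt_rec ac_simps\<close>)

lemma comm_id_totals:
  assumes "w \<in> evens" "w 7 = 1" "w 8 = 1" "w 9 = 1" "w 10 = 1" "w 11 = 1" "w 12 = 1" "w 5 = 0" "w 6 = 0"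
  shows "comm w (word [])"
  by (rule comm_by_walks[OF assms(1), where b = "[S,S,E,S,E,E,S,E,S]" and c = "[S,E,S,E]"
        and gs = "[[[S,S,E,S,E,E,S,E,S]], [[S,E,S,E]]]"
        and walks = "[[7,9],[8,12],[10,11],[2,1,3,4],[5],[6]]"])
    (use evens_sums[OF assms(1)] assms(2-) in \<open>simp_all add: edge_of_def upt_rec ac_simps\<close>)

lemma comm_id_mixed:
  assumes w: "w \<in> evens" and p: "p \<in> points" "w p = 0" and t: "t \<in> totals" "w t = 0"
  shows "comm w id"
proof -
  obtain f where f: "f \<in> \<Gamma>" "f 6 = p" using transitive_points[OF p(1)] .
  have "inv' f t \<in> totals" using Gamma_in_totals inv_Gamma f(1) t(1) by blast
  then obtain g where g: "g \<in> \<Gamma>" "g 6 = 6" "g 12 = inv' f t" using transitive_totals by blast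
  have fg: "f \<circ> g \<in> \<Gamma>" "(f \<circ> g) 6 = p" "(f \<circ> g) 12 = t" using f g by simp_all
  have "comm (act (inv' (f \<circ> g)) w) (word [])"
  proof (rule comm_id_fix)
    show "act (inv' (f \<circ> g)) w \<in> evens" using w fg(1) inv_Gamma evens_act by blast
    show "act (inv' (f \<circ> g)) w 6 = 0" "act (inv' (f \<circ> g)) w 12 = 0"
      unfolding act_inv_apply[OF fg(1)] fg(2,3) by (fact p(2) t(2))+
  qed
  then show ?thesis using comm_id_transfer[OF fg(1)] by (simp only: word.simps)
qed

lemma comm_id_points_ones:
  assumes w: "w \<in> evens" and p: "\<And>p. p \<in> points \<Longrightarrow> w p = 1" and t: "t \<in> totals" "w t = 0"
  shows "comm w id"
proof -
  obtain f where f: "f \<in> \<Gamma>" "f 12 = t" using transitive_totals[OF t(1)] by blast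
  let ?v = "act (inv' f) w"
  have v: "?v \<in> evens" "?v 12 = 0" "?v i = 1" if "i \<in> points" for i
    using w f t p[OF Gamma_in_points[OF f(1) that]] by (simp_all add: act_inv_apply)
  \<comment> \<open>The weight on the totals is even and the value at 12 is 0, so the other five
    values cannot all be 1. Powers of \<open>s12\<close> then bring a second zero to 11 without
    moving 12.\<close>
  have "\<exists>t\<in>{7, 8, 9, 10, 11}. ?v t = 0"
    using evens_sums(2)[of ?v] v(1,2)[of 1] by (cases "?v 7"; cases "?v 8"; cases "?v 9"; cases "?v 10"; cases "?v 11"; simp)
  then obtain t' where t': "t' \<in> {7, 8, 9, 10, 11}" "?v t' = 0" by blast
  obtain g where g: "g \<in> \<Gamma>" "g 12 = 12" "g 11 = t'" using rotate_totals[OF t'(1)] .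
  have "act (inv' g) ?v \<in> evens" using g v(1)[of 1] by simp
  moreover have "act (inv' g) ?v i = 1" if "i \<in> points" for i
    unfolding act_inv_apply[OF g(1)] by (rule v(3)) (rule Gamma_in_points[OF g(1) that])
  moreover have "act (inv' g) ?v 11 = 0" "act (inv' g) ?v 12 = 0"
    unfolding act_inv_apply[OF g(1)] g by (fact t'(2), rule v(2)[of 1], simp)
  ultimately have "comm (act (inv' g) ?v) (word [])"
    by (intro comm_id_points) simp_all
  then have "comm (act (inv' g) ?v) id" by (simp only: word.simps)
  from comm_id_transfer[OF g(1) this] show ?thesis by (rule comm_id_transfer[OF f(1)])
qed

lemma comm_id_totals_ones:
  assumes w: "w \<in> evens" and p: "\<And>p. p \<in> totals \<Longrightarrow> w p = 1" and t: "t \<in> points" "w t = 0"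
  shows "comm w id"
proof -
  obtain f where f: "f \<in> \<Gamma>" "f 6 = t" using transitive_points[OF t(1)] by blast
  let ?v = "act (inv' f) w"
  have v: "?v \<in> evens" "?v 6 = 0" "?v i = 1" if "i \<in> totals" for i
    using w f t p[OF Gamma_in_totals[OF f(1) that]] by (simp_all add: act_inv_apply)
  have "\<exists>t\<in>{1, 2, 3, 4, 5}. ?v t = 0"
    using evens_sums(1)[of ?v] v(1,2)[of 7] by (cases "?v 1"; cases "?v 2"; cases "?v 3"; cases "?v 4"; cases "?v 5"; simp)
  then obtain t' where t': "t' \<in> {1, 2, 3, 4, 5}" "?v t' = 0" by blast
  obtain g where g: "g \<in> \<Gamma>" "g 6 = 6" "g 5 = t'" using rotate_points[OF t'(1)] .
  have "act (inv' g) ?v \<in> evens" using g v(1)[of 7] by simp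
  moreover have "act (inv' g) ?v i = 1" if "i \<in> totals" for i
    unfolding act_inv_apply[OF g(1)] by (rule v(3)) (rule Gamma_in_totals[OF g(1) that])
  moreover have "act (inv' g) ?v 5 = 0" "act (inv' g) ?v 6 = 0"
    unfolding act_inv_apply[OF g(1)] g by (fact t'(2), rule v(2)[of 7], simp)
  ultimately have "comm (act (inv' g) ?v) (word [])"
    by (intro comm_id_totals) simp_all
  then have "comm (act (inv' g) ?v) id" by (simp only: word.simps)
  from comm_id_transfer[OF g(1) this] show ?thesis by (rule comm_id_transfer[OF f(1)])
qed

lemma comm_id:
  assumes w: "w \<in> evens" "w \<noteq> ones" shows "comm w id"
proof -
  have "\<exists>i\<in>points \<union> totals. w i = 0"
  proof (rule ccontr)
    assume *: "\<not> ?thesis"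
    have "w i = ones i" for i
    proof (cases "i \<in> {1..12}")
      case True
      then show ?thesis using * unfolding twelve_eq by (simp only: ind_def if_True) auto
    next
      case False
      then have "w i = 0" using w(1) by (simp add: evens_def)
      then show ?thesis using False by (simp only: ind_def if_False)
    qed
    then show False using w(2) by auto
  qed
  then obtain i where i: "i \<in> points \<or> i \<in> totals" "w i = 0" by blast
  show ?thesis
  proof (cases "(\<exists>p\<in>points. w p = 0) \<and> (\<exists>t\<in>totals. w t = 0)")
    case True
    then show ?thesis using comm_id_mixed[OF w(1)] by blast
  next
    case False
    from i(1) show ?thesis
    proof
      assume "i \<in> points"
      moreover from this have "w t = 1" if "t \<in> totals" for t
        using False i(2) that bit_not_zero_iff by blast
      ultimately show ?thesis using comm_id_totals_ones[OF w(1) _ _ i(2)] by blast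
    next
      assume "i \<in> totals"
      moreover from this have "w p = 1" if "p \<in> points" for p
        using False i(2) that bit_not_zero_iff by blast
      ultimately show ?thesis using comm_id_points_ones[OF w(1) _ _ i(2)] by blast
    qed
  qed
qed

subsection \<open>The exceptional element\<close>

definition halves :: "nat set \<Rightarrow> nat set \<Rightarrow> (nat \<Rightarrow> nat) \<Rightarrow> bool" where
  "halves A c g \<longleftrightarrow> g ` c = c \<or> g ` c = A - c"

text \<open>At worst g exchanges c with its complement in A, and a vector of even weight on A has
  the same sum over both.\<close>

lemma sum_act_halves:
  assumes g: "g \<in> \<Gamma>" and w: "w \<in> evens" and A: "A = points \<or> A = totals" "c \<subseteq> A" and "halves A c g"
  shows "sum (act g w) c = sum w c"
proof -
  have image: "sum (act g w) (g ` c) = sum w c"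
    using Gamma_bij[OF g] bij_is_inj
    by (subst sum.reindex) (auto simp: act_apply[OF g] intro: inj_on_subset)
  have "sum (act g w) (A - c) = sum (act g w) c"
  proof -
    have "sum (act g w) A = 0" using evens_act[OF w g] A by (auto simp: evens_def)
    moreover have "finite A" using A(1) by auto
    then have "sum (act g w) A = sum (act g w) (A - c) + sum (act g w) c"
      by (rule sum.subset_diff[OF A(2)])
    ultimately show ?thesis by (metis bit_add_self add.assoc add.commute add.right_neutral)
  qed
  then show ?thesis using assms(5) image unfolding halves_def by metis
qed

lemma of_nat_bit: "(of_nat n :: bit) = (if even n then 0 else 1)"
  by (induction n) simp_all

text \<open>Summing the commutator equation over c cancels all contributions of s and t. What
  remains is the parity of \<open>card c\<close>.\<close>

lemma not_comm_ones_halves: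
  assumes "A = points \<or> A = totals" "c \<subseteq> A" "odd (card c)" "halves A c a" "halves A c b"
    "a \<in> \<Gamma>" "b \<in> \<Gamma>" "s \<in> evens" "t \<in> evens"
  shows "ones + t + act b s \<noteq> s + act a t"
proof
  assume eq: "ones + t + act b s = s + act a t"
  have "sum (act b s) c = sum s c" "sum (act a t) c = sum t c"
    using assms by (simp_all add: sum_act_halves)
  moreover have "sum (ones + t + act b s) c = sum ones c + sum t c + sum (act b s) c"
    "sum (s + act a t) c = sum s c + sum (act a t) c"
    by (simp_all add: fun_apply sum.distrib)
  ultimately have "sum ones c + (sum t c + sum s c) = sum t c + sum s c"
    using eq by (simp add: ac_simps)
  then have "sum ones c = 0" by simp
  moreover have "sum ones c = (\<Sum>i\<in>c. 1)"
    using assms(1,2) by (intro sum.cong) (auto simp: ind_def)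
  ultimately show False using assms(3) by (simp add: of_nat_bit)
qed

definition odd_halves :: "(nat \<Rightarrow> nat) \<Rightarrow> (nat \<Rightarrow> nat) \<Rightarrow> bool" where
  "odd_halves a b \<longleftrightarrow>
     (\<exists>A c. (A = points \<or> A = totals) \<and> c \<subseteq> A \<and> odd (card c) \<and> halves A c a \<and> halves A c b)"

lemma odd_halves_commute: "odd_halves a b \<Longrightarrow> odd_halves b a"
  unfolding odd_halves_def by blast

lemma odd_halves_points: "c \<subseteq> points \<Longrightarrow> odd (card c) \<Longrightarrow> halves points c a \<Longrightarrow> halves points c b \<Longrightarrow> odd_halves a b"
  unfolding odd_halves_def by blast

lemma odd_halves_totals: "c \<subseteq> totals \<Longrightarrow> odd (card c) \<Longrightarrow> halves totals c a \<Longrightarrow> halves totals c b \<Longrightarrow> odd_halves a b"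
  unfolding odd_halves_def by blast

lemma halves_conj:
  assumes "h \<in> \<Gamma>" "halves A c g" "h ` A = A" "c \<subseteq> A"
  shows "halves A (h ` c) (h \<circ> g \<circ> inv' h)"
proof -
  have "inv' h ` h ` c = c"
    using inv_Gamma_cancel(3)[OF assms(1)] by (simp add: image_image)
  then have "(h \<circ> g \<circ> inv' h) ` h ` c = h ` g ` c"
    by (simp only: image_comp[symmetric])
  moreover have "h ` (A - c) = A - h ` c"
    using image_set_diff[OF bij_is_inj[OF Gamma_bij[OF assms(1)]]] assms(3) by simp
  ultimately show ?thesis using assms(2) unfolding halves_def by metis
qed

lemma odd_halves_conj:
  assumes h: "h \<in> \<Gamma>" and "odd_halves a b"
  shows "odd_halves (h \<circ> a \<circ> inv' h) (h \<circ> b \<circ> inv' h)"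
proof -
  obtain A c where A: "A = points \<or> A = totals" and c: "c \<subseteq> A" "odd (card c)" "halves A c a" "halves A c b"
    using assms(2) unfolding odd_halves_def by blast
  have hA: "h ` A = A" using A Gamma_points[OF h] Gamma_totals[OF h] by blast
  have "card (h ` c) = card c"
    using bij_is_inj[OF Gamma_bij[OF h]] by (intro card_image) (auto intro: inj_on_subset)
  then have "odd (card (h ` c))" "h ` c \<subseteq> A" using c hA by auto
  with A show ?thesis
    using halves_conj[OF h c(3) hA c(1)] halves_conj[OF h c(4) hA c(1)] unfolding odd_halves_def by blast
qed

section \<open>Odd sets invariant under each representative and its centralizer\<close>

lemma Gamma_distinct_points:
  assumes "b \<in> \<Gamma>"
  shows "b 1 \<in> points" "b 2 \<in> points" "b 3 \<in> points" "b 4 \<in> points" "b 5 \<in> points" "b 6 \<in> points"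
    "distinct [b 1, b 2, b 3, b 4, b 5, b 6]"
  using assms Gamma_in_points by (simp_all add: Gamma_eq_iff)

text \<open>Sharp transitivity moved to other points, for the representatives whose 4-cycle lies on
  3, 4, 5, 6.\<close>

lemma Gamma_eq_3456:
  assumes "g \<in> \<Gamma>" "h \<in> \<Gamma>" "g 3 = h 3" "g 4 = h 4" "g 5 = h 5" "g 6 = h 6"
  shows "g = h"
proof -
  obtain k where k: "k \<in> \<Gamma>" "k 1 = 3" "k 2 = 4" "k 3 = 5" "k 4 = 6"
    using four_transitive[of 3 4 5 6] by auto
  have "g \<circ> k = h \<circ> k"
    by (rule Gamma_eq_four) (use k assms in simp_all)
  then show ?thesis using inv_Gamma_cancel(1)[OF k(1)] by (metis comp_id o_assoc)
qed

lemma commute_apply: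
  assumes "b \<circ> g = g \<circ> b" shows "b (g i) = g (b i)"
  using assms by (metis comp_apply)

context
  fixes b assumes b: "b \<in> \<Gamma>"
begin

text \<open>A permutation commuting with a 5-cycle fixes its only fixed point.\<close>

lemma odd_halves_12345:
  assumes "b \<circ> word [S] = word [S] \<circ> b" shows "odd_halves (word [S]) b"
proof -
  have "s12 (b 6) = b 6" using commute_apply[OF assms, of 6] by simp
  then have "b 6 = 6" using Gamma_distinct_points(6)[OF b] unfolding points_eq
    by (elim insertE emptyE) simp_all
  then show ?thesis by (intro odd_halves_points[of "{6}"]) (simp_all add: halves_def)
qed

lemma odd_halves_12346:
  assumes "b \<circ> word [S,E,E] = word [S,E,E] \<circ> b" shows "odd_halves (word [S,E,E]) b"
proof -
  have "word [S,E,E] (b 5) = b 5" using commute_apply[OF assms, of 5] by simp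
  then have "b 5 = 5" using Gamma_distinct_points(5)[OF b] unfolding points_eq
    by (elim insertE emptyE) simp_all
  then show ?thesis by (intro odd_halves_points[of "{5}"]) (simp_all add: halves_def)
qed

text \<open>The centralizer of a 3-cycle preserves its support, which has odd size.\<close>

lemma odd_halves_123:
  assumes "b \<circ> word [S,S,E,S,E,S,S] = word [S,S,E,S,E,S,S] \<circ> b"
  shows "odd_halves (word [S,S,E,S,E,S,S]) b"
proof -
  have "b 2 = word [S,S,E,S,E,S,S] (b 1)" "b 3 = word [S,S,E,S,E,S,S] (b 2)"
    using commute_apply[OF assms, of 1] commute_apply[OF assms, of 2] by simp_all
  then have "b ` {1, 2, 3} = {1, 2, 3}"
    using Gamma_distinct_points(1,7)[OF b] unfolding points_eq
    by (elim insertE emptyE) (simp_all, auto)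
  then show ?thesis
    by (intro odd_halves_points[of "{1, 2, 3}"]) (simp_all add: halves_def insert_commute)
qed

lemma points_diff: "points - {1, 2, 3} = {4, 5, 6}" "points - {1, 2, 5} = {3, 4, 6}"
  "points - {1, 3, 5} = {2, 4, 6}" "points - {1, 3, 6} = {2, 4, 5}"
  unfolding points_eq by auto

text \<open>The centralizer permutes the two 3-cycles, and their supports are complementary sets of
  odd size.\<close>

lemma odd_halves_123_456:
  assumes "b \<circ> word [E,S,S,E,S,E,S,S] = word [E,S,S,E,S,E,S,S] \<circ> b"
  shows "odd_halves (word [E,S,S,E,S,E,S,S]) b"
proof -
  have "b 2 = word [E,S,S,E,S,E,S,S] (b 1)" "b 3 = word [E,S,S,E,S,E,S,S] (b 2)"
    using commute_apply[OF assms, of 1] commute_apply[OF assms, of 2] by simp_all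
  then have "b ` {1, 2, 3} = {1, 2, 3} \<or> b ` {1, 2, 3} = {4, 5, 6}"
    using Gamma_distinct_points(1)[OF b] unfolding points_eq
    by (elim insertE emptyE) (simp_all, auto)
  then show ?thesis
    by (intro odd_halves_points[of "{1, 2, 3}"]) (simp_all add: halves_def insert_commute points_diff)
qed

lemma odd_halves_123_465:
  assumes "b \<circ> word [E,E,S,S,E,S,E,S,S] = word [E,E,S,S,E,S,E,S,S] \<circ> b"
  shows "odd_halves (word [E,E,S,S,E,S,E,S,S]) b"
proof -
  have "b 2 = word [E,E,S,S,E,S,E,S,S] (b 1)" "b 3 = word [E,E,S,S,E,S,E,S,S] (b 2)"
    using commute_apply[OF assms, of 1] commute_apply[OF assms, of 2] by simp_all
  then have "b ` {1, 2, 3} = {1, 2, 3} \<or> b ` {1, 2, 3} = {4, 5, 6}"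
    using Gamma_distinct_points(1)[OF b] unfolding points_eq
    by (elim insertE emptyE) (simp_all, auto)
  then show ?thesis
    by (intro odd_halves_points[of "{1, 2, 3}"]) (simp_all add: halves_def insert_commute points_diff)
qed

text \<open>A permutation commuting with a cycle of length 4 is a power of it, as it is determined by
  its values on the cycle.\<close>

lemma odd_halves_1234_56:
  assumes "b \<circ> word [S,E] = word [S,E] \<circ> b" shows "odd_halves (word [S,E]) b"
proof -
  have eqs: "b 2 = word [S,E] (b 1)" "b 3 = word [S,E] (b 2)" "b 4 = word [S,E] (b 3)"
    using commute_apply[OF assms, of 1] commute_apply[OF assms, of 2] commute_apply[OF assms, of 3]
    by simp_all
  have "word [S,E] (b 5) = b 6" "word [S,E] (b 6) = b 5"
    using commute_apply[OF assms, of 5] commute_apply[OF assms, of 6] by simp_all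
  then have b56: "b 5 = 5 \<and> b 6 = 6 \<or> b 5 = 6 \<and> b 6 = 5"
    using Gamma_distinct_points(5)[OF b] unfolding points_eq
    by (elim insertE emptyE) auto
  have "b 1 = 1 \<or> b 1 = 2 \<or> b 1 = 3 \<or> b 1 = 4"
    using Gamma_distinct_points(1,7)[OF b] b56 unfolding points_eq by auto
  then have "\<exists>xs\<in>{[], [S,E], [S,E,S,E], [S,E,S,E,S,E]}. b 1 = word xs 1 \<and> b 2 = word xs 2 \<and> b 3 = word xs 3 \<and> b 4 = word xs 4"
    using eqs(1-3) by (elim disjE) simp_all
  then obtain xs where xs: "xs \<in> {[], [S,E], [S,E,S,E], [S,E,S,E,S,E]}" "b = word xs"
    using Gamma_eq_four[OF b word_in_Gamma] by blast
  \<comment> \<open>The set {1, 3, 5} takes every other letter of the cycles (1 2 3 4) and (5 6).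
    The representative therefore exchanges it with its complement, and each power preserves or
    exchanges it.\<close>
  then show ?thesis
    by (intro odd_halves_points[of "{1, 3, 5}"]) (auto simp: halves_def insert_commute points_diff)
qed

lemma odd_halves_12_3456:
  assumes "b \<circ> word [E,S,S,E,S,E,E,S,S] = word [E,S,S,E,S,E,E,S,S] \<circ> b"
  shows "odd_halves (word [E,S,S,E,S,E,E,S,S]) b"
proof -
  let ?r = "[E,S,S,E,S,E,E,S,S]"
  have eqs: "b 4 = word ?r (b 3)" "b 5 = word ?r (b 4)" "b 6 = word ?r (b 5)"
    using commute_apply[OF assms, of 3] commute_apply[OF assms, of 4] commute_apply[OF assms, of 5]
    by simp_all
  have "word ?r (b 1) = b 2" "word ?r (b 2) = b 1"
    using commute_apply[OF assms, of 1] commute_apply[OF assms, of 2] by simp_all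
  then have b12: "b 1 = 1 \<and> b 2 = 2 \<or> b 1 = 2 \<and> b 2 = 1"
    using Gamma_distinct_points(1)[OF b] unfolding points_eq
    by (elim insertE emptyE) auto
  have "b 3 = 3 \<or> b 3 = 4 \<or> b 3 = 5 \<or> b 3 = 6"
    using Gamma_distinct_points(3,7)[OF b] b12 unfolding points_eq by auto
  then have "\<exists>xs\<in>{[], ?r, ?r @ ?r, ?r @ ?r @ ?r}. b 3 = word xs 3 \<and> b 4 = word xs 4 \<and> b 5 = word xs 5 \<and> b 6 = word xs 6"
    using eqs(1-3) by (elim disjE) simp_all
  then obtain xs where xs: "xs \<in> {[], ?r, ?r @ ?r, ?r @ ?r @ ?r}" "b = word xs"
    using Gamma_eq_3456[OF b word_in_Gamma] by blast
  then show ?thesis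
    by (intro odd_halves_points[of "{1, 3, 5}"]) (auto simp: halves_def insert_commute points_diff)
qed

lemma odd_halves_12_3465:
  assumes "b \<circ> word [E,S,S,E,S,E,E,S,S,E] = word [E,S,S,E,S,E,E,S,S,E] \<circ> b"
  shows "odd_halves (word [E,S,S,E,S,E,E,S,S,E]) b"
proof -
  let ?r = "[E,S,S,E,S,E,E,S,S,E]"
  have eqs: "b 4 = word ?r (b 3)" "b 6 = word ?r (b 4)" "b 5 = word ?r (b 6)"
    using commute_apply[OF assms, of 3] commute_apply[OF assms, of 4] commute_apply[OF assms, of 6]
    by simp_all
  have "word ?r (b 1) = b 2" "word ?r (b 2) = b 1"
    using commute_apply[OF assms, of 1] commute_apply[OF assms, of 2] by simp_all
  then have b12: "b 1 = 1 \<and> b 2 = 2 \<or> b 1 = 2 \<and> b 2 = 1"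
    using Gamma_distinct_points(1)[OF b] unfolding points_eq
    by (elim insertE emptyE) auto
  have "b 3 = 3 \<or> b 3 = 4 \<or> b 3 = 5 \<or> b 3 = 6"
    using Gamma_distinct_points(3,7)[OF b] b12 unfolding points_eq by auto
  then have "\<exists>xs\<in>{[], ?r, ?r @ ?r, ?r @ ?r @ ?r}. b 3 = word xs 3 \<and> b 4 = word xs 4 \<and> b 5 = word xs 5 \<and> b 6 = word xs 6"
    using eqs(1-3) by (elim disjE) simp_all
  then obtain xs where xs: "xs \<in> {[], ?r, ?r @ ?r, ?r @ ?r @ ?r}" "b = word xs"
    using Gamma_eq_3456[OF b word_in_Gamma] by blast
  \<comment> \<open>Here the 4-cycle runs 3, 4, 6, 5, so every other letter of it gives 3 and
    6.\<close>
  then show ?thesis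
    by (intro odd_halves_points[of "{1, 3, 6}"]) (auto simp: halves_def insert_commute points_diff)
qed

text \<open>The centralizer is dihedral of order 8, no longer cyclic, and {5} serves only for those
  b that fix 5. This is the one class where points may fail and totals are used.\<close>

lemma odd_halves_12_34:
  assumes "b \<circ> word [S,S,E,S,E,E,S,E,S] = word [S,S,E,S,E,E,S,E,S] \<circ> b"
  shows "odd_halves (word [S,S,E,S,E,E,S,E,S]) b"
proof -
  let ?r = "[S,S,E,S,E,E,S,E,S]"
  have eqs: "b 2 = word ?r (b 1)" "b 4 = word ?r (b 3)" "word ?r (b 5) = b 5" "word ?r (b 6) = b 6"
    using commute_apply[OF assms, of 1] commute_apply[OF assms, of 3] commute_apply[OF assms, of 5]
      commute_apply[OF assms, of 6] by simp_all
  have b56: "b 5 = 5 \<or> b 5 = 6" "b 6 = 5 \<or> b 6 = 6"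
    using Gamma_distinct_points(5,6)[OF b] eqs(3,4) unfolding points_eq
    by (elim insertE emptyE; simp)+
  show ?thesis
  proof (cases "b 5 = 5")
    case True
    then show ?thesis by (intro odd_halves_points[of "{5}"]) (simp_all add: halves_def)
  next
    case False
    then have b5: "b 5 = 6" "b 6 = 5"
      using b56 Gamma_distinct_points(7)[OF b] by auto
    \<comment> \<open>Words for the eight permutations of {1, 2, 3, 4} commuting with (1 2)(3 4).
      The four in \<open>?odd\<close> are even there, so in A6 they fix 5 and 6 and are excluded.
      The other four exchange 5 and 6: double transpositions in \<open>?fix\<close>, elements with a
      4-cycle in \<open>?swap\<close>.\<close>
    let ?odd = "{[], ?r, [S,E,S,E], [E,S,E,S,S,E,S,E,E,S,E]}"
    let ?fix = "{[E,E,S,E,S,E,S,S], [S,E,E,S,E,S,S,S]}"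
    let ?swap = "{[S,E,S,S,E,S,E,S,S], [S,S,E,S,S,E,S,E,E,S,S]}"
    have "b 1 = 1 \<or> b 1 = 2 \<or> b 1 = 3 \<or> b 1 = 4" "b 3 = 1 \<or> b 3 = 2 \<or> b 3 = 3 \<or> b 3 = 4"
      using Gamma_distinct_points(1,3,7)[OF b] b5 unfolding points_eq by auto
    then have "b 1 = 1 \<and> b 2 = 2 \<or> b 1 = 2 \<and> b 2 = 1 \<or> b 1 = 3 \<and> b 2 = 4 \<or> b 1 = 4 \<and> b 2 = 3"
      "b 3 = 1 \<and> b 4 = 2 \<or> b 3 = 2 \<and> b 4 = 1 \<or> b 3 = 3 \<and> b 4 = 4 \<or> b 3 = 4 \<and> b 4 = 3"
      using eqs(1,2) by (elim disjE; simp)+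
    moreover have "b 1 \<noteq> b 3" "b 1 \<noteq> b 4" using Gamma_distinct_points(7)[OF b] by simp_all
    ultimately have "(b 1 = 1 \<and> b 2 = 2 \<or> b 1 = 2 \<and> b 2 = 1) \<and> (b 3 = 3 \<and> b 4 = 4 \<or> b 3 = 4 \<and> b 4 = 3) \<or>
      (b 1 = 3 \<and> b 2 = 4 \<or> b 1 = 4 \<and> b 2 = 3) \<and> (b 3 = 1 \<and> b 4 = 2 \<or> b 3 = 2 \<and> b 4 = 1)"
      by (elim disjE conjE) simp_all
    then have "map b [1, 2, 3, 4] \<in> {[1, 2, 3, 4], [2, 1, 4, 3], [3, 4, 1, 2], [4, 3, 2, 1],
        [1, 2, 4, 3], [2, 1, 3, 4], [3, 4, 2, 1], [4, 3, 1, 2]}"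
      by (elim disjE conjE) simp_all
    also have "\<dots> \<subseteq> (\<lambda>xs. map (word xs) [1, 2, 3, 4]) ` (?odd \<union> ?fix \<union> ?swap)"
      by simp
    finally obtain xs where xs: "xs \<in> ?odd \<union> ?fix \<union> ?swap" "map b [1, 2, 3, 4] = map (word xs) [1, 2, 3, 4]"
      by (rule imageE)
    then have "b = word xs" by (intro Gamma_eq_four b word_in_Gamma) simp_all
    note xs = xs(1) this
    have "xs \<notin> ?odd"
    proof
      assume "xs \<in> ?odd"
      then have "word xs 5 = 5" by (elim insertE emptyE) simp_all
      then show False using xs(2) b5(1) by simp
    qed
    with xs(1) consider "xs \<in> ?fix" | "xs \<in> ?swap" by blast
    then show ?thesis
    proof cases
      case 1
      \<comment> \<open>Now b and (1 2)(3 4) generate the Klein four-group with orbits {1, 2}, {3,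
        4}, {5, 6} on points. Each of its elements fixes a point, so none maps a set to its
        complement, and invariant sets of points have even size. On totals the group fixes
        10.\<close>
      then show ?thesis unfolding xs(2)
        by (intro odd_halves_totals[of "{10}"]) (auto simp: halves_def)
    next
      case 2
      \<comment> \<open>Here b exchanges {1, 2} with {3, 4} and 5 with 6, hence {1, 2, 5} with its
        complement, while (1 2)(3 4) preserves {1, 2, 5}.\<close>
      then show ?thesis unfolding xs(2)
        by (intro odd_halves_points[of "{1, 2, 5}"]) (auto simp: halves_def insert_commute points_diff)
    qed
  qed
qed

end

lemma odd_halves_rep:
  assumes "xs \<in> class_reps" "b \<in> \<Gamma>" "b \<circ> word xs = word xs \<circ> b"
  shows "odd_halves (word xs) b"
  using assms odd_halves_1234_56 odd_halves_12345 odd_halves_12346 odd_halves_12_34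
    odd_halves_12_3456 odd_halves_12_3465 odd_halves_123 odd_halves_123_456 odd_halves_123_465
  unfolding class_reps_def by (elim insertE emptyE) blast+

text \<open>A simultaneous conjugation turns a nontrivial member of the pair into a representative;
  the condition is symmetric and invariant under conjugation.\<close>

lemma odd_halves_commuting:
  assumes a: "a \<in> \<Gamma>" and b: "b \<in> \<Gamma>" and ab: "a \<circ> b = b \<circ> a"
  shows "odd_halves a b"
proof -
  have *: "odd_halves a b" if ne: "a \<noteq> id" and a: "a \<in> \<Gamma>" and b: "b \<in> \<Gamma>" and ab: "a \<circ> b = b \<circ> a" for a b
  proof -
    obtain h xs where h: "h \<in> \<Gamma>" and xs: "xs \<in> class_reps" "a = h \<circ> word xs \<circ> inv' h"
      using Gamma_conj_rep[OF a ne] .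
    have a': "word xs = inv' h \<circ> a \<circ> h"
      unfolding xs(2) using h by (simp add: fun_eq_iff)
    let ?b = "inv' h \<circ> b \<circ> h"
    have "?b \<circ> word xs = inv' h \<circ> (b \<circ> a) \<circ> h" "word xs \<circ> ?b = inv' h \<circ> (a \<circ> b) \<circ> h"
      unfolding a' using h by (simp_all add: fun_eq_iff)
    then have "odd_halves (word xs) ?b"
      using odd_halves_rep[OF xs(1)] h b ab by simp
    from odd_halves_conj[OF h this] show ?thesis
      unfolding xs(2)[symmetric] using h by (simp add: fun_eq_iff o_def)
  qed
  show ?thesis
  proof (cases "a = id")
    case True
    show ?thesis
    proof (cases "b = id")
      case b_id: True
      show ?thesis unfolding True b_id
        by (rule odd_halves_points[of "{1}"]) (simp_all add: halves_def)
    next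
      case False
      then show ?thesis using *[OF False b a] ab odd_halves_commute by metis
    qed
  next
    case False
    then show ?thesis using * assms by blast
  qed
qed

lemma not_comm_ones: "\<not> comm ones id"
proof
  assume "comm ones id"
  then obtain s t a b where st: "s \<in> evens" "t \<in> evens" "a \<in> \<Gamma>" "b \<in> \<Gamma>"
    and ba: "b \<circ> a = a \<circ> b" and eq: "ones + t + act b s = s + act a t"
    unfolding comm_def by auto
  have "odd_halves a b" using odd_halves_commuting st(3,4) ba by metis
  then show False using not_comm_ones_halves[OF _ _ _ _ _ st(3,4,1,2)] eq
    unfolding odd_halves_def by blast
qed

lemma comm_iff:
  assumes "w \<in> evens" "g \<in> \<Gamma>" shows "comm w g \<longleftrightarrow> \<not> (w = ones \<and> g = id)"
  using assms comm_nontrivial comm_id not_comm_ones by blast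

subsection \<open>The center\<close>

lemma ind_evens: "ind points \<in> evens" "ind totals \<in> evens"
  unfolding evens_def by (auto simp: ind_def)

text \<open>Invariant vectors are constant on the two orbits, points and totals. Both orbits have
  six letters, so all four such vectors are even.\<close>

lemma fixed_vectors:
  assumes "s \<in> evens"
  shows "(\<forall>g\<in>\<Gamma>. act g s = s) \<longleftrightarrow> s \<in> {0, ind points, ind totals, ones}"
proof
  assume fixed: "\<forall>g\<in>\<Gamma>. act g s = s"
  have eq: "s (g i) = s i" if "g \<in> \<Gamma>" for g i
    using act_apply[OF that, of s i] fixed that by simp
  have p: "s i = s 6" if "i \<in> points" for i
    using that eq[OF s12_Gamma, of 1] eq[OF s12_Gamma, of 2] eq[OF s12_Gamma, of 3] eq[OF s12_Gamma, of 4]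
      eq[OF e12_Gamma, of 4] eq[OF e12_Gamma, of 5] unfolding points_eq
    by (elim insertE emptyE) simp_all
  have t: "s i = s 12" if "i \<in> totals" for i
    using that eq[OF s12_Gamma, of 7] eq[OF s12_Gamma, of 8] eq[OF s12_Gamma, of 9] eq[OF s12_Gamma, of 10]
      eq[OF e12_Gamma, of 9] eq[OF e12_Gamma, of 11] unfolding totals_eq
    by (elim insertE emptyE) simp_all
  have "s i = (if i \<in> points then s 6 else if i \<in> totals then s 12 else 0)" for i
  proof -
    have "s i = 0" if "i \<notin> points" "i \<notin> totals"
      using assms that unfolding evens_def twelve_eq by blast
    then show ?thesis using p[of i] t[of i] by (simp del: atLeastAtMost_iff split: if_split)
  qed
  then have s_eq: "s = (\<lambda>i. if i \<in> points then s 6 else if i \<in> totals then s 12 else 0)" by (rule ext)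
  have step: "(\<lambda>i. if i \<in> points then x else if i \<in> totals then y else 0) \<in> {0, ind points, ind totals, ones}"
    for x y :: bit
  proof -
    have "(\<lambda>i. if i \<in> points then 0 else if i \<in> totals then 0 else 0) = (0 :: nat \<Rightarrow> bit)"
      "(\<lambda>i. if i \<in> points then 1 else if i \<in> totals then 0 else 0) = ind points"
      "(\<lambda>i. if i \<in> points then 0 else if i \<in> totals then 1 else 0) = ind totals"
      "(\<lambda>i. if i \<in> points then 1 else if i \<in> totals then 1 else 0) = ones"
      by (rule ext; auto simp: ind_def zero_fun_apply)+
    then show ?thesis by (cases x; cases y) blast+
  qed
  show "s \<in> {0, ind points, ind totals, ones}"
    using step[of "s 6" "s 12"] unfolding s_eq[symmetric] .
next
  assume s: "s \<in> {0, ind points, ind totals, ones}"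
  have "ind A = act g (ind A)" if "g \<in> \<Gamma>" "g ` A = A" for g A
  proof (rule act_eqI[OF that(1)])
    fix i
    have "g i \<in> A \<longleftrightarrow> i \<in> A"
      using that Gamma_eq_iff[OF that(1)] by (metis imageE imageI)
    then show "ind A (g i) = ind A i" by (simp add: ind_def)
  qed
  moreover have "g ` {1..12} = {1..12}" if "g \<in> \<Gamma>" for g
    unfolding twelve_eq image_Un Gamma_points[OF that] Gamma_totals[OF that] ..
  ultimately show "\<forall>g\<in>\<Gamma>. act g s = s"
    using s Gamma_points Gamma_totals by (auto simp del: atLeastAtMost_iff)
qed

text \<open>A central element equals all its conjugates, so a nontrivial one would itself be a
  representative; none of the nine commutes with both generators.\<close>

lemma Gamma_centerless:
  assumes g: "g \<in> \<Gamma>" and commute: "\<And>h. h \<in> \<Gamma> \<Longrightarrow> g \<circ> h = h \<circ> g"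
  shows "g = id"
proof (rule ccontr)
  assume "g \<noteq> id"
  then obtain h xs where h: "h \<in> \<Gamma>" "xs \<in> class_reps" "g = h \<circ> word xs \<circ> inv' h"
    using Gamma_conj_rep[OF g] by blast
  have "g = inv' h \<circ> g \<circ> h"
    using commute[OF h(1)] h(1) by (simp add: fun_eq_iff)
  also have "\<dots> = word xs" unfolding h(3) using h(1) by (simp add: fun_eq_iff)
  finally have "word xs (s12 i) = s12 (word xs i)" "word xs (e12 i) = e12 (word xs i)" for i
    using commute[OF s12_Gamma] commute[OF e12_Gamma] by (metis comp_apply)+
  from this(1)[of 6] this(1)[of 1] this(1)[of 2] this(2)[of 1] this(2)[of 2] this(2)[of 4] h(2)
  show False
    unfolding class_reps_def by (elim insertE emptyE) simp_all
qed

lemma ind_distinct: "card {0, ind points, ind totals, ones} = 4"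
proof -
  have "distinct (map (\<lambda>w. (w 1, w 7)) [0, ind points, ind totals, ones])"
    by (simp add: ind_def fun_apply)
  then have "distinct [0, ind points, ind totals, ones]"
    by (simp only: distinct_map)
  from distinct_card[OF this] show ?thesis by simp
qed

section \<open>The model as a semidirect product\<close>

text \<open>These twelve linear functionals are permuted by the two matrices as the letters are by
  \<open>s12\<close> and \<open>e12\<close>.\<close>

definition coords :: "bit vec \<Rightarrow> nat \<Rightarrow> bit" where
  "coords v i =
    (if i = 1 then v $ 9
     else if i = 2 then v $ 5 + v $ 6 + v $ 9
     else if i = 3 then v $ 5 + v $ 7 + v $ 8
     else if i = 4 then v $ 7
     else if i = 5 then v $ 8
     else if i = 6 then v $ 6
     else if i = 7 then v $ 0 + v $ 3
     else if i = 8 then v $ 1 + v $ 2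
     else if i = 9 then v $ 1 + v $ 4
     else if i = 10 then v $ 0 + v $ 1 + v $ 2 + v $ 3 + v $ 4
     else if i = 11 then v $ 0
     else if i = 12 then v $ 0 + v $ 1
     else 0)"

text \<open>Obtained by solving \<open>coords\<close> for the ten entries. The letters 3 and 10 do
  not occur because even weight determines the values there.\<close>

definition vec_of :: "(nat \<Rightarrow> bit) \<Rightarrow> bit vec" where
  "vec_of x = vec_of_list [x 11, x 11 + x 12, x 8 + x 11 + x 12, x 7 + x 11, x 9 + x 11 + x 12,
     x 1 + x 2 + x 6, x 6, x 4, x 5, x 1]"

lemma vec_of_carrier [simp]: "vec_of x \<in> carrier_vec 10"
  by (rule carrier_vecI) (simp add: vec_of_def del: vec_of_list_Cons)

lemma vec_of_index:
  "vec_of x $ 0 = x 11" "vec_of x $ 1 = x 11 + x 12" "vec_of x $ 2 = x 8 + x 11 + x 12"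
  "vec_of x $ 3 = x 7 + x 11" "vec_of x $ 4 = x 9 + x 11 + x 12" "vec_of x $ 5 = x 1 + x 2 + x 6"
  "vec_of x $ 6 = x 6" "vec_of x $ 7 = x 4" "vec_of x $ 8 = x 5" "vec_of x $ 9 = x 1"
  unfolding vec_of_def vec_of_list_index by simp_all

lemma coords_apply:
  "coords v 1 = v $ 9" "coords v 2 = v $ 5 + v $ 6 + v $ 9" "coords v 3 = v $ 5 + v $ 7 + v $ 8"
  "coords v 4 = v $ 7" "coords v 5 = v $ 8" "coords v 6 = v $ 6" "coords v 7 = v $ 0 + v $ 3"
  "coords v 8 = v $ 1 + v $ 2" "coords v 9 = v $ 1 + v $ 4"
  "coords v 10 = v $ 0 + v $ 1 + v $ 2 + v $ 3 + v $ 4" "coords v 11 = v $ 0" "coords v 12 = v $ 0 + v $ 1"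
  by (simp_all add: coords_def)

lemma coords_outside: "i \<notin> {1..12} \<Longrightarrow> coords v i = 0"
  by (auto simp: coords_def)

lemma coords_evens [simp]: "coords v \<in> evens"
proof -
  have "sum (coords v) points = 0" "sum (coords v) totals = 0"
    unfolding points_eq totals_eq by (simp_all add: coords_apply ac_simps)
  then show ?thesis unfolding evens_def using coords_outside by blast
qed

lemma eq_twelveI:
  assumes "\<And>i. i \<notin> {1..12} \<Longrightarrow> x i = y i"
    "x 1 = y 1" "x 2 = y 2" "x 3 = y 3" "x 4 = y 4" "x 5 = y 5" "x 6 = y 6"
    "x 7 = y 7" "x 8 = y 8" "x 9 = y 9" "x 10 = y 10" "x 11 = y 11" "x 12 = y 12"
  shows "x = (y :: nat \<Rightarrow> bit)"
proof
  fix i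
  show "x i = y i"
  proof (cases "i \<in> {1..12}")
    case True
    then have "i \<in> {1, 2, 3, 4, 5, 6, 7, 8, 9, 10, 11, 12}"
      unfolding twelve_eq points_eq totals_eq by blast
    then show ?thesis using assms(2-) by (elim insertE emptyE) (simp_all only:)
  qed (rule assms(1))
qed

lemma vec10_eqI:
  assumes "v \<in> carrier_vec 10" "w \<in> carrier_vec 10"
    "v $ 0 = w $ 0" "v $ 1 = w $ 1" "v $ 2 = w $ 2" "v $ 3 = w $ 3" "v $ 4 = w $ 4"
    "v $ 5 = w $ 5" "v $ 6 = w $ 6" "v $ 7 = w $ 7" "v $ 8 = w $ 8" "v $ 9 = w $ 9"
  shows "v = w"
proof (rule eq_vecI)
  fix i assume "i < dim_vec w"
  then have "i \<in> {0, 1, 2, 3, 4, 5, 6, 7, 8, 9}" using assms(2) by auto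
  then show "v $ i = w $ i" using assms(3-) by (elim insertE emptyE) (simp_all only:)
qed (use assms in auto)

lemma bit_add_eq_zero: "a + b = 0 \<longleftrightarrow> a = b" for a b :: bit
  by (cases a; cases b) simp_all

lemma coords_vec_of:
  assumes "x \<in> evens" shows "coords (vec_of x) = x"
proof (rule eq_twelveI)
  fix i :: nat assume "i \<notin> {1..12}"
  then show "coords (vec_of x) i = x i"
    using assms coords_outside unfolding evens_def by (metis (mono_tags, lifting) mem_Collect_eq)
next
  have "x 3 + (x 1 + x 2 + x 4 + x 5 + x 6) = 0" "x 10 + (x 7 + x 8 + x 9 + x 11 + x 12) = 0"
    using evens_sums[OF assms] by (simp_all add: ac_simps)
  then have x: "x 3 = x 1 + x 2 + x 4 + x 5 + x 6" "x 10 = x 7 + x 8 + x 9 + x 11 + x 12"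
    unfolding bit_add_eq_zero by blast+
  show "coords (vec_of x) 3 = x 3" "coords (vec_of x) 10 = x 10"
    unfolding x by (simp_all add: coords_apply vec_of_index ac_simps)
qed (simp_all add: coords_apply vec_of_index ac_simps)

lemma vec_of_coords: "v \<in> carrier_vec 10 \<Longrightarrow> vec_of (coords v) = v"
  by (rule vec10_eqI) (simp_all add: coords_apply vec_of_index ac_simps)

lemma coords_eq_iff: "v \<in> carrier_vec 10 \<Longrightarrow> w \<in> carrier_vec 10 \<Longrightarrow> coords v = coords w \<longleftrightarrow> v = w"
  by (metis vec_of_coords)

lemma coords_add:
  assumes "v \<in> carrier_vec 10" "w \<in> carrier_vec 10"
  shows "coords (v + w) = coords v + coords w"
proof (rule eq_twelveI)
  fix i :: nat assume "i \<notin> {1..12}"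
  then show "coords (v + w) i = (coords v + coords w) i"
    by (simp add: coords_outside fun_apply del: atLeastAtMost_iff)
qed (use assms in \<open>simp_all add: coords_apply fun_apply ac_simps\<close>)

lemma vec_of_add:
  assumes "x \<in> evens" "y \<in> evens" shows "vec_of (x + y) = vec_of x + vec_of y"
proof -
  have "coords (vec_of (x + y)) = coords (vec_of x + vec_of y)"
    using assms by (simp add: coords_vec_of coords_add)
  then show ?thesis by (simp add: coords_eq_iff)
qed

lemma coords_q: "coords q = ones"
proof (rule eq_twelveI)
  fix i :: nat assume "i \<notin> {1..12}"
  then show "coords q i = ones i" by (simp add: coords_outside ind_def del: atLeastAtMost_iff)
qed (simp_all add: coords_apply q_def vec_of_list_index ind_def del: vec_of_list_Cons)

lemma q_carrier: "q \<in> carrier_vec 10"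
  by (rule carrier_vecI) (simp add: q_def del: vec_of_list_Cons)

lemma mat_of_rows_list_carrier: "length rs = m \<Longrightarrow> mat_of_rows_list n rs \<in> carrier_mat m n"
  by (auto simp: mat_of_rows_list_def)

lemma M_sigma_carrier: "M_\<sigma> \<in> carrier_mat 10 10"
  unfolding M_\<sigma>_def by (rule mat_of_rows_list_carrier) simp

lemma M_eta_carrier: "M_\<eta> \<in> carrier_mat 10 10"
  unfolding M_\<eta>_def by (rule mat_of_rows_list_carrier) simp

lemma rows_list_mult_vec:
  assumes "length rs = 10" "i < 10" "length (rs ! i) = 10" "v \<in> carrier_vec 10"
  shows "(mat_of_rows_list 10 rs *\<^sub>v v) $ i = (\<Sum>j\<leftarrow>[0,1,2,3,4,5,6,7,8,9]. rs ! i ! j * v $ j)"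
proof -
  have "(mat_of_rows_list 10 rs *\<^sub>v v) $ i = (\<Sum>j\<in>{0..<10}. rs ! i ! j * v $ j)"
    using assms by (auto simp: mat_of_rows_list_def scalar_prod_def intro!: sum.cong)
  also have "{0..<10::nat} = set [0,1,2,3,4,5,6,7,8,9]" by auto
  also have "(\<Sum>j\<in>set [0,1,2,3,4,5,6,7,8,9]. rs ! i ! j * v $ j) =
      (\<Sum>j\<leftarrow>[0,1,2,3,4,5,6,7,8,9]. rs ! i ! j * v $ j)"
    by (rule sum.distinct_set_conv_list) simp
  finally show ?thesis .
qed

lemma M_sigma_apply:
  assumes "v \<in> carrier_vec 10"
  shows "(M_\<sigma> *\<^sub>v v) $ 0 = v $ 0 + v $ 1 + v $ 2 + v $ 3 + v $ 4"
    "(M_\<sigma> *\<^sub>v v) $ 1 = v $ 2 + v $ 3 + v $ 4"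
    "(M_\<sigma> *\<^sub>v v) $ 2 = v $ 0 + v $ 2 + v $ 4"
    "(M_\<sigma> *\<^sub>v v) $ 3 = v $ 1 + v $ 2 + v $ 3 + v $ 4"
    "(M_\<sigma> *\<^sub>v v) $ 4 = v $ 1 + v $ 3 + v $ 4"
    "(M_\<sigma> *\<^sub>v v) $ 5 = v $ 6 + v $ 8 + v $ 9"
    "(M_\<sigma> *\<^sub>v v) $ 6 = v $ 6"
    "(M_\<sigma> *\<^sub>v v) $ 7 = v $ 5 + v $ 7 + v $ 8"
    "(M_\<sigma> *\<^sub>v v) $ 8 = v $ 7"
    "(M_\<sigma> *\<^sub>v v) $ 9 = v $ 8"
  unfolding M_\<sigma>_def using assms by (simp_all add: rows_list_mult_vec ac_simps)

lemma M_eta_apply: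
  assumes "v \<in> carrier_vec 10"
  shows "(M_\<eta> *\<^sub>v v) $ 0 = v $ 1 + v $ 4"
    "(M_\<eta> *\<^sub>v v) $ 1 = v $ 0 + v $ 1 + v $ 4"
    "(M_\<eta> *\<^sub>v v) $ 2 = v $ 1 + v $ 3 + v $ 4"
    "(M_\<eta> *\<^sub>v v) $ 3 = v $ 0 + v $ 2 + v $ 3"
    "(M_\<eta> *\<^sub>v v) $ 4 = v $ 4"
    "(M_\<eta> *\<^sub>v v) $ 5 = v $ 5 + v $ 6 + v $ 8"
    "(M_\<eta> *\<^sub>v v) $ 6 = v $ 8"
    "(M_\<eta> *\<^sub>v v) $ 7 = v $ 6"
    "(M_\<eta> *\<^sub>v v) $ 8 = v $ 7"
    "(M_\<eta> *\<^sub>v v) $ 9 = v $ 9"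
  unfolding M_\<eta>_def using assms by (simp_all add: rows_list_mult_vec ac_simps)

lemma coords_M_sigma:
  assumes "v \<in> carrier_vec 10" shows "coords (M_\<sigma> *\<^sub>v v) = act s12 (coords v)"
proof (rule act_eqI[OF s12_Gamma])
  have "(\<lambda>i. coords (M_\<sigma> *\<^sub>v v) (s12 i)) = coords v"
  proof (rule eq_twelveI)
    fix i :: nat assume "i \<notin> {1..12}"
    then show "coords (M_\<sigma> *\<^sub>v v) (s12 i) = coords v i"
      using Gamma_outside[OF s12_Gamma, of i] coords_outside[of i] by simp
  qed (simp_all add: coords_apply M_sigma_apply[OF assms] ac_simps)
  then show "coords (M_\<sigma> *\<^sub>v v) (s12 i) = coords v i" for i by metis
qed

lemma coords_M_eta:
  assumes "v \<in> carrier_vec 10" shows "coords (M_\<eta> *\<^sub>v v) = act e12 (coords v)"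
proof (rule act_eqI[OF e12_Gamma])
  have "(\<lambda>i. coords (M_\<eta> *\<^sub>v v) (e12 i)) = coords v"
  proof (rule eq_twelveI)
    fix i :: nat assume "i \<notin> {1..12}"
    then show "coords (M_\<eta> *\<^sub>v v) (e12 i) = coords v i"
      using Gamma_outside[OF e12_Gamma, of i] coords_outside[of i] by simp
  qed (simp_all add: coords_apply M_eta_apply[OF assms] ac_simps)
  then show "coords (M_\<eta> *\<^sub>v v) (e12 i) = coords v i" for i by metis
qed

lemma vec_of_act_sigma: "v \<in> carrier_vec 10 \<Longrightarrow> vec_of (act s12 (coords v)) = M_\<sigma> *\<^sub>v v"
  using M_sigma_carrier by (simp add: vec_of_coords flip: coords_M_sigma)

lemma vec_of_act_eta: "v \<in> carrier_vec 10 \<Longrightarrow> vec_of (act e12 (coords v)) = M_\<eta> *\<^sub>v v"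
  using M_eta_carrier by (simp add: vec_of_coords flip: coords_M_eta)

subsection \<open>Automorphisms and their matrices\<close>

lemma bit_vec_add_self: "v \<in> carrier_vec n \<Longrightarrow> v + v = 0\<^sub>v n" for v :: "bit vec"
  by (rule eq_vecI) auto

lemma hom_Z2_10_iff:
  "f \<in> hom Z2_10 Z2_10 \<longleftrightarrow> f \<in> carrier_vec 10 \<rightarrow> carrier_vec 10 \<and>
     (\<forall>v\<in>carrier_vec 10. \<forall>w\<in>carrier_vec 10. f (v + w) = f v + f w)"
  by (simp add: hom_def monoid_vec_simps)

lemma aut_mat_carrier: "aut_mat f \<in> carrier_mat 10 10"
  unfolding aut_mat_def by (rule carrier_matI) simp_all

lemma mat_mult_unit_vec:
  fixes A :: "bit mat"
  assumes "A \<in> carrier_mat n n" "j < n" shows "A *\<^sub>v unit_vec n j = col A j"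
  using assms by (intro eq_vecI) auto

lemma aut_mat_eq:
  assumes "A \<in> carrier_mat 10 10" "\<And>j. j < 10 \<Longrightarrow> f (unit_vec 10 j) = A *\<^sub>v unit_vec 10 j"
  shows "aut_mat f = A"
proof -
  have "map (\<lambda>j. f (unit_vec 10 j)) [0..<10] = cols A"
    using assms by (auto simp: cols_def mat_mult_unit_vec)
  then show ?thesis unfolding aut_mat_def using mat_of_cols_cols[of A] assms(1) by auto
qed

text \<open>Over the field with two elements additive maps are linear. In the induction
  \<open>trunc k\<close> keeps the first k entries of v; the next step adds nothing or one basis
  vector.\<close>

lemma aut_mat_apply:
  assumes f: "f \<in> hom Z2_10 Z2_10" and v: "v \<in> carrier_vec 10"
  shows "aut_mat f *\<^sub>v v = f v"
proof -
  have f_add: "f (x + y) = f x + f y" if "x \<in> carrier_vec 10" "y \<in> carrier_vec 10" for x y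
    using f that unfolding hom_Z2_10_iff by blast
  have f_carrier: "f x \<in> carrier_vec 10" if "x \<in> carrier_vec 10" for x
    using f that unfolding hom_Z2_10_iff by blast
  have "f (0\<^sub>v 10) = f (0\<^sub>v 10 + 0\<^sub>v 10)" by simp
  also have "\<dots> = f (0\<^sub>v 10) + f (0\<^sub>v 10)" by (intro f_add) simp_all
  also have "\<dots> = 0\<^sub>v 10" using f_carrier[of "0\<^sub>v 10"] by (intro bit_vec_add_self) simp
  finally have f_zero: "f (0\<^sub>v 10) = 0\<^sub>v 10" .
  have f_unit: "aut_mat f *\<^sub>v unit_vec 10 j = f (unit_vec 10 j)" if "j < 10" for j
  proof -
    have "aut_mat f *\<^sub>v unit_vec 10 j = col (aut_mat f) j"
      using mat_mult_unit_vec[OF aut_mat_carrier that] .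
    also have "\<dots> = f (unit_vec 10 j)"
      using that f_carrier[of "unit_vec 10 j"] unfolding aut_mat_def by (subst col_mat_of_cols) auto
    finally show ?thesis .
  qed
  define trunc where "trunc k = vec 10 (\<lambda>i. if i < k then v $ i else 0)" for k
  have trunc_carrier: "trunc k \<in> carrier_vec 10" for k by (simp add: trunc_def)
  have "aut_mat f *\<^sub>v trunc k = f (trunc k)" if "k \<le> 10" for k
    using that
  proof (induction k)
    case 0
    have "trunc 0 = 0\<^sub>v 10" by (rule eq_vecI) (simp_all add: trunc_def)
    moreover have "aut_mat f *\<^sub>v 0\<^sub>v 10 = 0\<^sub>v 10"
      using aut_mat_carrier[of f] by (intro eq_vecI) auto
    ultimately show ?case using f_zero by simp
  next
    case (Suc k)
    show ?case
    proof (cases "v $ k = 0")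
      case True
      then have "trunc (Suc k) = trunc k"
        by (intro eq_vecI) (auto simp: trunc_def less_Suc_eq)
      then show ?thesis using Suc by simp
    next
      case False
      then have "trunc (Suc k) = trunc k + unit_vec 10 k"
        using Suc.prems by (intro eq_vecI) (auto simp: trunc_def unit_vec_def less_Suc_eq)
      then show ?thesis
        using Suc f_unit[of k] aut_mat_carrier[of f]
        by (simp add: mult_add_distrib_mat_vec[OF aut_mat_carrier trunc_carrier] f_add trunc_carrier)
    qed
  qed
  moreover have "trunc 10 = v" using v by (intro eq_vecI) (auto simp: trunc_def)
  ultimately show ?thesis by (metis order_refl)
qed

lemma auto_Z2_10D:
  assumes "f \<in> auto Z2_10"
  shows "f \<in> hom Z2_10 Z2_10" "f \<in> Bij (carrier_vec 10)"
  using assms by (auto simp: auto_def monoid_vec_simps)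

lemma AutoGroup_Z2_10:
  shows "carrier (AutoGroup Z2_10) = auto Z2_10"
    "f \<in> auto Z2_10 \<Longrightarrow> g \<in> auto Z2_10 \<Longrightarrow>
      f \<otimes>\<^bsub>AutoGroup Z2_10\<^esub> g = compose (carrier_vec 10) f g"
  by (auto simp: AutoGroup_def BijGroup_def monoid_vec_simps dest: auto_Z2_10D)

lemma group_AutoGroup_Z2_10: "group (AutoGroup Z2_10)"
  by (rule group.AutoGroup) (rule comm_group.axioms(2)[OF comm_group_vec])

section \<open>Existence of the homomorphism\<close>

definition lift :: "(nat \<Rightarrow> nat) \<Rightarrow> nat \<Rightarrow> nat" where
  "lift = inv_into \<Gamma> on_points"

lemma lift_on_points [simp]: "g \<in> \<Gamma> \<Longrightarrow> lift (on_points g) = g"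
  unfolding lift_def by (rule inv_into_f_f[OF on_points_inj])

text \<open>The action of the model carried over to vectors. The restricted abstraction makes each
  value extensional, as membership in \<open>auto Z2_10\<close> demands.\<close>

definition \<Phi> :: "(nat \<Rightarrow> nat) \<Rightarrow> bit vec \<Rightarrow> bit vec" where
  "\<Phi> \<alpha> = (\<lambda>v\<in>carrier_vec 10. vec_of (act (lift \<alpha>) (coords v)))"

lemma Phi_apply: "g \<in> \<Gamma> \<Longrightarrow> v \<in> carrier_vec 10 \<Longrightarrow> \<Phi> (on_points g) v = vec_of (act g (coords v))"
  by (simp add: \<Phi>_def)

lemma Phi_auto:
  assumes "g \<in> \<Gamma>" shows "\<Phi> (on_points g) \<in> auto Z2_10"
proof -
  have "\<Phi> (on_points g) \<in> hom Z2_10 Z2_10"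
    unfolding hom_Z2_10_iff using assms
    by (auto simp: Phi_apply coords_add act_add vec_of_add)
  moreover have "bij_betw (\<Phi> (on_points g)) (carrier_vec 10) (carrier_vec 10)"
  proof (rule bij_betw_byWitness[where f' = "\<Phi> (on_points (inv' g))"])
    show "\<forall>v\<in>carrier_vec 10. \<Phi> (on_points (inv' g)) (\<Phi> (on_points g) v) = v"
      "\<forall>v\<in>carrier_vec 10. \<Phi> (on_points g) (\<Phi> (on_points (inv' g)) v) = v"
      using assms by (simp_all add: Phi_apply coords_vec_of vec_of_coords)
    show "\<Phi> (on_points g) ` carrier_vec 10 \<subseteq> carrier_vec 10"
      "\<Phi> (on_points (inv' g)) ` carrier_vec 10 \<subseteq> carrier_vec 10"
      using assms by (auto simp: Phi_apply)
  qed
  moreover have "\<Phi> (on_points g) \<in> extensional (carrier_vec 10)"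
    by (simp add: \<Phi>_def)
  ultimately show ?thesis by (simp add: auto_def Bij_def monoid_vec_simps)
qed

lemma Phi_hom: "\<Phi> \<in> hom (alt_group 6) (AutoGroup Z2_10)"
proof (rule homI)
  fix \<alpha> assume "\<alpha> \<in> carrier (alt_group 6)"
  then obtain g where "g \<in> \<Gamma>" "on_points g = \<alpha>" by (rule on_points_surj)
  then show "\<Phi> \<alpha> \<in> carrier (AutoGroup Z2_10)"
    unfolding AutoGroup_Z2_10 using Phi_auto by blast
next
  fix \<alpha> \<beta> assume "\<alpha> \<in> carrier (alt_group 6)" "\<beta> \<in> carrier (alt_group 6)"
  then obtain g h where g: "g \<in> \<Gamma>" "on_points g = \<alpha>" and h: "h \<in> \<Gamma>" "on_points h = \<beta>"
    using on_points_surj by metis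
  have "\<Phi> (on_points (g \<circ> h)) = compose (carrier_vec 10) (\<Phi> (on_points g)) (\<Phi> (on_points h))"
  proof
    fix v
    show "\<Phi> (on_points (g \<circ> h)) v = compose (carrier_vec 10) (\<Phi> (on_points g)) (\<Phi> (on_points h)) v"
    proof (cases "v \<in> carrier_vec 10")
      case True
      have "\<Phi> (on_points (g \<circ> h)) v = vec_of (act (g \<circ> h) (coords v))"
        by (rule Phi_apply[OF comp_Gamma[OF g(1) h(1)] True])
      also have "\<dots> = \<Phi> (on_points g) (\<Phi> (on_points h) v)"
        unfolding act_comp[OF g(1) h(1)] using g(1) h(1) True by (simp add: Phi_apply coords_vec_of)
      finally show ?thesis using True by (simp add: compose_eq)
    qed (simp add: \<Phi>_def compose_def)
  qed
  then show "\<Phi> (\<alpha> \<otimes>\<^bsub>alt_group 6\<^esub> \<beta>) = \<Phi> \<alpha> \<otimes>\<^bsub>AutoGroup Z2_10\<^esub> \<Phi> \<beta>"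
    unfolding alt_group_mult g(2)[symmetric] h(2)[symmetric] on_points_comp[OF h(1)]
      AutoGroup_Z2_10(2)[OF Phi_auto[OF g(1)] Phi_auto[OF h(1)]] .
qed

lemma aut_mat_Phi_sigma: "aut_mat (\<Phi> \<sigma>) = M_\<sigma>"
  unfolding on_points_s12[symmetric]
  by (rule aut_mat_eq[OF M_sigma_carrier]) (simp add: Phi_apply vec_of_act_sigma)

lemma aut_mat_Phi_eta: "aut_mat (\<Phi> \<eta>) = M_\<eta>"
  unfolding on_points_e12[symmetric]
  by (rule aut_mat_eq[OF M_eta_carrier]) (simp add: Phi_apply vec_of_act_eta)

text \<open>The inverse is the matrix belonging to \<open>inv' g\<close>, checked column by column.
  At \<open>s12\<close> and \<open>e12\<close> this gives the invertibility of
  \<open>M_\<sigma>\<close> and \<open>M_\<eta>\<close>.\<close>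

lemma aut_mat_Phi_GL10:
  assumes "g \<in> \<Gamma>" shows "aut_mat (\<Phi> (on_points g)) \<in> carrier GL10"
proof -
  have *: "aut_mat (\<Phi> (on_points g)) * aut_mat (\<Phi> (on_points h)) = 1\<^sub>m 10"
    if g: "g \<in> \<Gamma>" and h: "h \<in> \<Gamma>" and gh: "\<And>w. act g (act h w) = w" for g h
  proof (rule mat_col_eqI)
    fix j :: nat assume "j < dim_col (1\<^sub>m 10 :: bit mat)"
    then have j: "j < 10" by simp
    let ?A = "aut_mat (\<Phi> (on_points g))" and ?B = "aut_mat (\<Phi> (on_points h))" and ?e = "unit_vec 10 j :: bit vec"
    have "col (?A * ?B) j = (?A * ?B) *\<^sub>v ?e"
      by (rule mat_mult_unit_vec[symmetric, OF mult_carrier_mat[OF aut_mat_carrier aut_mat_carrier] j])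
    also have "\<dots> = ?A *\<^sub>v (?B *\<^sub>v ?e)"
      by (rule assoc_mult_mat_vec[OF aut_mat_carrier aut_mat_carrier]) simp
    also have "\<dots> = ?e"
      using g h gh by (simp add: aut_mat_apply auto_Z2_10D(1)[OF Phi_auto] Phi_apply coords_vec_of vec_of_coords)
    also have "\<dots> = col (1\<^sub>m 10) j" using j by simp
    finally show "col (?A * ?B) j = col (1\<^sub>m 10) j" .
  qed (use aut_mat_carrier in auto)
  have "aut_mat (\<Phi> (on_points g)) * aut_mat (\<Phi> (on_points (inv' g))) = 1\<^sub>m 10"
    "aut_mat (\<Phi> (on_points (inv' g))) * aut_mat (\<Phi> (on_points g)) = 1\<^sub>m 10"
    using assms by (auto intro!: *)
  then show ?thesis
    using aut_mat_carrier unfolding units_of_def Units_def ring_mat_simps by (simp add: ring_mat_simps) blast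
qed

section \<open>The semidirect product\<close>

text \<open>The form of the commutator equation without inverses, to match
  \<open>comm\<close>.\<close>

lemma (in group) derived_set_iff:
  assumes "x \<in> carrier G"
  shows "x \<in> derived_set G (carrier G) \<longleftrightarrow> (\<exists>g\<in>carrier G. \<exists>h\<in>carrier G. x \<otimes> (h \<otimes> g) = g \<otimes> h)"
proof -
  have "x = g \<otimes> h \<otimes> inv g \<otimes> inv h \<longleftrightarrow> x \<otimes> (h \<otimes> g) = g \<otimes> h"
    if "g \<in> carrier G" "h \<in> carrier G" for g h
  proof -
    have "x = g \<otimes> h \<otimes> inv (h \<otimes> g) \<longleftrightarrow> x \<otimes> (h \<otimes> g) = g \<otimes> h"
      using assms that inv_solve_right by auto
    then show ?thesis using that by (simp add: inv_mult_group m_assoc)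
  qed
  then show ?thesis by auto
qed

section \<open>Transfer from the model to every \<phi> with the prescribed matrices\<close>

context
  fixes \<phi> :: "(nat \<Rightarrow> nat) \<Rightarrow> bit vec \<Rightarrow> bit vec"
  assumes hom_phi: "\<phi> \<in> hom (alt_group 6) (AutoGroup Z2_10)"
    and phi_sigma: "aut_mat (\<phi> \<sigma>) = M_\<sigma>" and phi_eta: "aut_mat (\<phi> \<eta>) = M_\<eta>"
begin

lemma phi_auto: "\<alpha> \<in> carrier (alt_group 6) \<Longrightarrow> \<phi> \<alpha> \<in> auto Z2_10"
  using hom_in_carrier[OF hom_phi] unfolding AutoGroup_Z2_10 .

lemma phi_comp:
  assumes "\<alpha> \<in> carrier (alt_group 6)" "\<beta> \<in> carrier (alt_group 6)" "v \<in> carrier_vec 10"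
  shows "\<phi> (\<alpha> \<circ> \<beta>) v = \<phi> \<alpha> (\<phi> \<beta> v)"
proof -
  have "\<phi> (\<alpha> \<circ> \<beta>) = compose (carrier_vec 10) (\<phi> \<alpha>) (\<phi> \<beta>)"
    using hom_mult[OF hom_phi assms(1,2)]
    unfolding alt_group_mult AutoGroup_Z2_10(2)[OF phi_auto[OF assms(1)] phi_auto[OF assms(2)]] .
  then show ?thesis using assms(3) by (simp add: compose_eq)
qed

lemma phi_carrier: "\<alpha> \<in> carrier (alt_group 6) \<Longrightarrow> v \<in> carrier_vec 10 \<Longrightarrow> \<phi> \<alpha> v \<in> carrier_vec 10"
  using auto_Z2_10D(1)[OF phi_auto] unfolding hom_Z2_10_iff by blast

text \<open>The values at two generators determine \<phi>: induction on words propagates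
  \<open>coords_M_sigma\<close> and \<open>coords_M_eta\<close> through products.\<close>

lemma coords_phi:
  assumes "g \<in> \<Gamma>" "v \<in> carrier_vec 10"
  shows "coords (\<phi> (on_points g) v) = act g (coords v)"
  using assms(1)
proof (induction rule: Gamma_induct)
  case id
  interpret hom: group_hom "alt_group 6" "AutoGroup Z2_10" \<phi>
    using alt_group_is_group group_AutoGroup_Z2_10 hom_phi by (simp add: group_hom_def group_hom_axioms_def)
  have phi_id: "\<phi> (on_points id) = (\<lambda>v\<in>carrier_vec 10. v)"
    using hom.hom_one unfolding on_points_id
    by (simp add: alt_group_one AutoGroup_def BijGroup_def monoid_vec_simps)
  show ?case unfolding act_id phi_id using assms(2) by simp
next
  case (s12 g)
  have "\<phi> (on_points (s12 \<circ> g)) v = \<phi> \<sigma> (\<phi> (on_points g) v)"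
    unfolding on_points_comp[OF s12(1)] on_points_s12
    by (rule phi_comp[OF sigma_alt on_points_alt[OF s12(1)] assms(2)])
  also have "\<dots> = M_\<sigma> *\<^sub>v \<phi> (on_points g) v"
    unfolding phi_sigma[symmetric]
    by (rule aut_mat_apply[symmetric]) (use assms(2) s12(1) in \<open>simp_all add: auto_Z2_10D phi_auto sigma_alt phi_carrier on_points_alt\<close>)
  finally show ?case
    unfolding act_comp[OF s12_Gamma s12(1)] s12(2)[symmetric]
    using coords_M_sigma[OF phi_carrier[OF on_points_alt[OF s12(1)] assms(2)]] by (simp only:)
next
  case (e12 g)
  have "\<phi> (on_points (e12 \<circ> g)) v = \<phi> \<eta> (\<phi> (on_points g) v)"
    unfolding on_points_comp[OF e12(1)] on_points_e12
    by (rule phi_comp[OF eta_alt on_points_alt[OF e12(1)] assms(2)])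
  also have "\<dots> = M_\<eta> *\<^sub>v \<phi> (on_points g) v"
    unfolding phi_eta[symmetric]
    by (rule aut_mat_apply[symmetric]) (use assms(2) e12(1) in \<open>simp_all add: auto_Z2_10D phi_auto eta_alt phi_carrier on_points_alt\<close>)
  finally show ?case
    unfolding act_comp[OF e12_Gamma e12(1)] e12(2)[symmetric]
    using coords_M_eta[OF phi_carrier[OF on_points_alt[OF e12(1)] assms(2)]] by (simp only:)
qed

definition elem :: "(nat \<Rightarrow> bit) \<Rightarrow> (nat \<Rightarrow> nat) \<Rightarrow> bit vec \<times> (nat \<Rightarrow> nat)" where
  "elem x g = (vec_of x, on_points g)"

lemma carrier_semidirect: "carrier (semidirect \<phi>) = {elem x g | x g. x \<in> evens \<and> g \<in> \<Gamma>}"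
proof -
  have "(v, \<alpha>) \<in> {elem x g | x g. x \<in> evens \<and> g \<in> \<Gamma>}"
    if "v \<in> carrier_vec 10" "\<alpha> \<in> carrier (alt_group 6)" for v \<alpha>
    using that on_points_surj[OF that(2)] vec_of_coords[OF that(1)] coords_evens[of v]
    unfolding elem_def mem_Collect_eq by metis
  then show ?thesis
    by (auto simp: semidirect_def monoid_vec_simps elem_def on_points_alt)
qed

lemma elem_carrier: "x \<in> evens \<Longrightarrow> g \<in> \<Gamma> \<Longrightarrow> elem x g \<in> carrier (semidirect \<phi>)"
  unfolding carrier_semidirect by blast

lemma elem_eq_iff:
  assumes "x \<in> evens" "y \<in> evens" "g \<in> \<Gamma>" "h \<in> \<Gamma>"
  shows "elem x g = elem y h \<longleftrightarrow> x = y \<and> g = h"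
  using assms coords_vec_of lift_on_points unfolding elem_def by (metis prod.inject)

lemma elem_mult:
  assumes "x \<in> evens" "y \<in> evens" "g \<in> \<Gamma>" "h \<in> \<Gamma>"
  shows "elem x g \<otimes>\<^bsub>semidirect \<phi>\<^esub> elem y h = elem (x + act g y) (g \<circ> h)"
proof -
  have "aut_mat (\<phi> (on_points g)) *\<^sub>v vec_of y = \<phi> (on_points g) (vec_of y)"
    using assms by (simp add: aut_mat_apply auto_Z2_10D phi_auto on_points_alt)
  also have "\<dots> = vec_of (act g y)"
    using coords_phi[OF assms(3), of "vec_of y"] assms phi_carrier[OF on_points_alt[OF assms(3)], of "vec_of y"]
    by (metis coords_vec_of vec_of_carrier vec_of_coords)
  finally show ?thesis
    using assms by (simp add: semidirect_def elem_def alt_group_mult on_points_comp vec_of_add)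
qed

lemma elem_one: "\<one>\<^bsub>semidirect \<phi>\<^esub> = elem 0 id"
proof -
  have "vec_of 0 = 0\<^sub>v 10"
    by (rule vec10_eqI) (simp_all add: vec_of_index zero_fun_apply)
  then show ?thesis
    unfolding elem_def on_points_id by (simp add: semidirect_def monoid_vec_simps alt_group_one)
qed

lemma group_semidirect: "group (semidirect \<phi>)"
proof (rule groupI)
  show "\<one>\<^bsub>semidirect \<phi>\<^esub> \<in> carrier (semidirect \<phi>)"
    unfolding elem_one by (rule elem_carrier) simp_all
next
  fix a b assume "a \<in> carrier (semidirect \<phi>)" "b \<in> carrier (semidirect \<phi>)"
  then obtain x g y h where xg: "x \<in> evens" "g \<in> \<Gamma>" "a = elem x g" and yh: "y \<in> evens" "h \<in> \<Gamma>" "b = elem y h"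
    unfolding carrier_semidirect by blast
  then show "a \<otimes>\<^bsub>semidirect \<phi>\<^esub> b \<in> carrier (semidirect \<phi>)"
    by (simp only: elem_mult) (rule elem_carrier, simp_all)
next
  fix a b c assume "a \<in> carrier (semidirect \<phi>)" "b \<in> carrier (semidirect \<phi>)" "c \<in> carrier (semidirect \<phi>)"
  then obtain x g y h z k where xg: "x \<in> evens" "g \<in> \<Gamma>" "a = elem x g"
    and yh: "y \<in> evens" "h \<in> \<Gamma>" "b = elem y h" and zk: "z \<in> evens" "k \<in> \<Gamma>" "c = elem z k"
    unfolding carrier_semidirect by blast
  show "a \<otimes>\<^bsub>semidirect \<phi>\<^esub> b \<otimes>\<^bsub>semidirect \<phi>\<^esub> c = a \<otimes>\<^bsub>semidirect \<phi>\<^esub> (b \<otimes>\<^bsub>semidirect \<phi>\<^esub> c)"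
    unfolding xg(3) yh(3) zk(3)
    using xg(1,2) yh(1,2) zk(1,2) by (simp only: elem_mult evens_add evens_act comp_Gamma act_comp act_add add.assoc o_assoc)
next
  fix a assume "a \<in> carrier (semidirect \<phi>)"
  then obtain x g where xg: "x \<in> evens" "g \<in> \<Gamma>" "a = elem x g"
    unfolding carrier_semidirect by blast
  show "\<one>\<^bsub>semidirect \<phi>\<^esub> \<otimes>\<^bsub>semidirect \<phi>\<^esub> a = a"
    unfolding elem_one xg(3) elem_mult[OF evens_zero xg(1) id_Gamma xg(2)] by simp
  have "elem (act (inv' g) x) (inv' g) \<otimes>\<^bsub>semidirect \<phi>\<^esub> a = \<one>\<^bsub>semidirect \<phi>\<^esub>"
    unfolding elem_one xg(3) elem_mult[OF evens_act[OF xg(1) inv_Gamma[OF xg(2)]] xg(1) inv_Gamma[OF xg(2)] xg(2)]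
      inv_Gamma_cancel(2)[OF xg(2)] by simp
  then show "\<exists>b\<in>carrier (semidirect \<phi>). b \<otimes>\<^bsub>semidirect \<phi>\<^esub> a = \<one>\<^bsub>semidirect \<phi>\<^esub>"
    using elem_carrier xg by (meson evens_act inv_Gamma)
qed

lemma elem_derived_set_iff:
  assumes "x \<in> evens" "g \<in> \<Gamma>"
  shows "elem x g \<in> derived_set (semidirect \<phi>) (carrier (semidirect \<phi>)) \<longleftrightarrow> comm x g"
proof -
  have "(\<exists>a\<in>carrier (semidirect \<phi>). \<exists>b\<in>carrier (semidirect \<phi>).
      elem x g \<otimes>\<^bsub>semidirect \<phi>\<^esub> (b \<otimes>\<^bsub>semidirect \<phi>\<^esub> a) = a \<otimes>\<^bsub>semidirect \<phi>\<^esub> b) \<longleftrightarrow>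
    (\<exists>s\<in>evens. \<exists>t\<in>evens. \<exists>a\<in>\<Gamma>. \<exists>b\<in>\<Gamma>. elem x g \<otimes>\<^bsub>semidirect \<phi>\<^esub> (elem t b \<otimes>\<^bsub>semidirect \<phi>\<^esub> elem s a) =
      elem s a \<otimes>\<^bsub>semidirect \<phi>\<^esub> elem t b)"
    unfolding carrier_semidirect by blast
  also have "\<dots> \<longleftrightarrow> comm x g"
    unfolding comm_def
  proof (intro bex_cong refl)
    fix s t a b assume *: "s \<in> evens" "t \<in> evens" "a \<in> \<Gamma>" "b \<in> \<Gamma>"
    have "elem x g \<otimes>\<^bsub>semidirect \<phi>\<^esub> (elem t b \<otimes>\<^bsub>semidirect \<phi>\<^esub> elem s a) =
        elem (x + act g (t + act b s)) (g \<circ> (b \<circ> a))"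
      using assms * by (simp only: elem_mult evens_add evens_act comp_Gamma)
    moreover have "elem s a \<otimes>\<^bsub>semidirect \<phi>\<^esub> elem t b = elem (s + act a t) (a \<circ> b)"
      using * by (simp only: elem_mult)
    ultimately show "elem x g \<otimes>\<^bsub>semidirect \<phi>\<^esub> (elem t b \<otimes>\<^bsub>semidirect \<phi>\<^esub> elem s a) =
        elem s a \<otimes>\<^bsub>semidirect \<phi>\<^esub> elem t b \<longleftrightarrow>
      g \<circ> b \<circ> a = a \<circ> b \<and> x + act g t + act (g \<circ> b) s = s + act a t"
      using assms * elem_eq_iff[of "x + act g (t + act b s)" "s + act a t" "g \<circ> (b \<circ> a)" "a \<circ> b"]
      by (simp only: evens_add evens_act comp_Gamma act_add act_comp add.assoc o_assoc) blast
  qed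
  finally show ?thesis
    unfolding group.derived_set_iff[OF group_semidirect elem_carrier[OF assms]] .
qed

lemma u_elem: "u = elem ones id"
  unfolding u_def elem_def on_points_id coords_q[symmetric] vec_of_coords[OF q_carrier] ..

lemma ones_evens: "ones \<in> evens"
  using coords_evens[of q] unfolding coords_q .

lemma noncommutators_semidirect: "noncommutators (semidirect \<phi>) = {u}"
proof -
  have iff: "elem x g \<in> noncommutators (semidirect \<phi>) \<longleftrightarrow> elem x g = u" if "x \<in> evens" "g \<in> \<Gamma>" for x g
    unfolding noncommutators_def u_elem elem_eq_iff[OF that(1) ones_evens that(2) id_Gamma]
      Diff_iff elem_derived_set_iff[OF that] comm_iff[OF that]
    using elem_carrier[OF that] by (simp only: simp_thms)
  have "y = u" if y: "y \<in> noncommutators (semidirect \<phi>)" for y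
  proof -
    have "y \<in> carrier (semidirect \<phi>)" using y unfolding noncommutators_def by (rule DiffD1)
    then obtain x g where xg: "x \<in> evens" "g \<in> \<Gamma>" "y = elem x g"
      unfolding carrier_semidirect by blast
    show ?thesis using iff[OF xg(1,2)] y unfolding xg(3) by (simp only:)
  qed
  moreover have "u \<in> noncommutators (semidirect \<phi>)"
    using iff[OF ones_evens id_Gamma] unfolding u_elem by (simp only: simp_thms)
  ultimately show ?thesis by blast
qed

lemma elem_center_iff:
  assumes "x \<in> evens" "g \<in> \<Gamma>"
  shows "elem x g \<in> center (semidirect \<phi>) \<longleftrightarrow> x \<in> {0, ind points, ind totals, ones} \<and> g = id"
proof -
  have "elem x g \<in> center (semidirect \<phi>) \<longleftrightarrow>
      (\<forall>y\<in>evens. \<forall>h\<in>\<Gamma>. elem x g \<otimes>\<^bsub>semidirect \<phi>\<^esub> elem y h = elem y h \<otimes>\<^bsub>semidirect \<phi>\<^esub> elem x g)"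
    unfolding center_def using elem_carrier[OF assms] unfolding carrier_semidirect by blast
  also have "\<dots> \<longleftrightarrow> (\<forall>y\<in>evens. \<forall>h\<in>\<Gamma>. x + act g y = y + act h x \<and> g \<circ> h = h \<circ> g)"
  proof (intro ball_cong refl)
    fix y h assume "y \<in> evens" "h \<in> \<Gamma>"
    then show "elem x g \<otimes>\<^bsub>semidirect \<phi>\<^esub> elem y h = elem y h \<otimes>\<^bsub>semidirect \<phi>\<^esub> elem x g \<longleftrightarrow>
        x + act g y = y + act h x \<and> g \<circ> h = h \<circ> g"
      using assms by (simp only: elem_mult elem_eq_iff evens_add evens_act comp_Gamma)
  qed
  also have "\<dots> \<longleftrightarrow> g = id \<and> (\<forall>h\<in>\<Gamma>. act h x = x)"
  proof
    assume *: "\<forall>y\<in>evens. \<forall>h\<in>\<Gamma>. x + act g y = y + act h x \<and> g \<circ> h = h \<circ> g"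
    then have "g = id" using Gamma_centerless[OF assms(2)] evens_zero by blast
    moreover have "act h x = x" if "h \<in> \<Gamma>" for h
    proof -
      \<comment> \<open>Commuting with the elements (0, h) already forces x to be invariant.\<close>
      have "x + act g 0 = 0 + act h x" using * that evens_zero by blast
      then show ?thesis by simp
    qed
    ultimately show "g = id \<and> (\<forall>h\<in>\<Gamma>. act h x = x)" by blast
  next
    assume "g = id \<and> (\<forall>h\<in>\<Gamma>. act h x = x)"
    then show "\<forall>y\<in>evens. \<forall>h\<in>\<Gamma>. x + act g y = y + act h x \<and> g \<circ> h = h \<circ> g"
      by (simp only: act_id id_comp comp_id add.commute) simp
  qed
  finally show ?thesis using fixed_vectors[OF assms(1)] by blast
qed

lemma center_semidirect:
  "center (semidirect \<phi>) = (\<lambda>x. elem x id) ` {0, ind points, ind totals, ones}"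
proof -
  have reps: "x \<in> evens" if "x \<in> {0, ind points, ind totals, ones}" for x
    using that ind_evens ones_evens evens_zero by blast
  have "y \<in> (\<lambda>x. elem x id) ` {0, ind points, ind totals, ones}" if y: "y \<in> center (semidirect \<phi>)" for y
  proof -
    have "y \<in> carrier (semidirect \<phi>)" using y unfolding center_def by blast
    then obtain x g where xg: "x \<in> evens" "g \<in> \<Gamma>" "y = elem x g"
      unfolding carrier_semidirect by blast
    have "x \<in> {0, ind points, ind totals, ones}" "g = id"
      using y unfolding xg(3) elem_center_iff[OF xg(1,2)] by simp_all
    then show ?thesis unfolding xg(3) by blast
  qed
  moreover have "elem x id \<in> center (semidirect \<phi>)" if "x \<in> {0, ind points, ind totals, ones}" for x
    unfolding elem_center_iff[OF reps[OF that] id_Gamma] using that by simp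
  ultimately show ?thesis by blast
qed

lemma u_center: "u \<in> center (semidirect \<phi>)"
  unfolding u_elem center_semidirect by blast

lemma card_center: "card (center (semidirect \<phi>)) = 4"
proof -
  have "inj_on (\<lambda>x. elem x id) {0, ind points, ind totals, ones}"
  proof (rule inj_onI)
    fix x y assume "x \<in> {0, ind points, ind totals, ones}" "y \<in> {0, ind points, ind totals, ones}"
      and eq: "elem x id = elem y id"
    then have "x \<in> evens" "y \<in> evens" using ind_evens ones_evens evens_zero by blast+
    then show "x = y" using elem_eq_iff[OF _ _ id_Gamma id_Gamma] eq by blast
  qed
  then show ?thesis unfolding center_semidirect using ind_distinct by (simp only: card_image)
qed

end

theorem mainTheorem2:
  shows "generate (alt_group 6) {\<sigma>, \<eta>} = carrier (alt_group 6)
    \<and> M_\<sigma> \<in> carrier GL10 \<and> M_\<eta> \<in> carrier GL10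
    \<and> (\<exists>\<phi> \<in> hom (alt_group 6) (AutoGroup Z2_10).
         aut_mat (\<phi> \<sigma>) = M_\<sigma> \<and> aut_mat (\<phi> \<eta>) = M_\<eta>)
    \<and> (\<forall>\<phi> \<in> hom (alt_group 6) (AutoGroup Z2_10).
         aut_mat (\<phi> \<sigma>) = M_\<sigma> \<and> aut_mat (\<phi> \<eta>) = M_\<eta> \<longrightarrow>
           card (center (semidirect \<phi>)) = 4
         \<and> u \<in> center (semidirect \<phi>)
         \<and> noncommutators (semidirect \<phi>) = {u})"
proof (intro conjI ballI impI)
  show "generate (alt_group 6) {\<sigma>, \<eta>} = carrier (alt_group 6)"
    by (rule generate_sigma_eta)
  show "M_\<sigma> \<in> carrier GL10" "M_\<eta> \<in> carrier GL10"
    using aut_mat_Phi_GL10[OF s12_Gamma] aut_mat_Phi_GL10[OF e12_Gamma]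
    unfolding on_points_s12 on_points_e12 aut_mat_Phi_sigma aut_mat_Phi_eta .
  show "\<exists>\<phi> \<in> hom (alt_group 6) (AutoGroup Z2_10). aut_mat (\<phi> \<sigma>) = M_\<sigma> \<and> aut_mat (\<phi> \<eta>) = M_\<eta>"
    using Phi_hom aut_mat_Phi_sigma aut_mat_Phi_eta by blast
  fix \<phi> assume "\<phi> \<in> hom (alt_group 6) (AutoGroup Z2_10)" "aut_mat (\<phi> \<sigma>) = M_\<sigma> \<and> aut_mat (\<phi> \<eta>) = M_\<eta>"
  then show "card (center (semidirect \<phi>)) = 4" "u \<in> center (semidirect \<phi>)"
    "noncommutators (semidirect \<phi>) = {u}"
    using card_center u_center noncommutators_semidirect by blast+
qed

end
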